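(* Let $\mathcal{H}$ be a separable Hilbert space, $I$ a countable index set, and $\varphi=\{\varphi_i\}_{i\in I}$ and $\psi=\{\psi_i\}_{i\in I}$ two frames for $\mathcal{H}$. The following hold. (i) If $S_\varphi^{-1}\ge I_{\mathcal{H}}$ and $S_\varphi S_{\varphi_J}=S_{\varphi_J}S_\varphi$ for all $J\subseteq I$, then $\{\varphi_i\}_{i\in I}$ and $\{S_\varphi^{-1}\varphi_i\}_{i\in I}$ are woven. (ii) If $\varphi$ and $\psi$ are two woven Riesz bases for $\mathcal{H}$ and $T_1,T_2$ are bounded invertible operators on $\mathcal{H}$ such that $$d_{\varphi_J,\psi_{J^c}}>\max\left\{\Vert T_1-T_2\Vert\,\Vert T_1^{-1}\Vert,\ \Vert T_1-T_2\Vert\,\Vert T_2^{-1}\Vert\right\}\quad\text{for all } J\subseteq I,$$ then $T_1\varphi=\{T_1\varphi_i\}_{i\in I}$ and $T_2\psi=\{T_2\psi_i\}_{i\in I}$ are woven.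
   Context: A family $\{\varphi_i\}_{i\in I}$ in $\mathcal{H}$ is a frame for $\mathcal{H}$ with bounds $0<A\le B<\infty$ if $A\Vert f\Vert^2\le\sum_{i\in I}|\langle f,\varphi_i\rangle|^2\le B\Vert f\Vert^2$ for all $f\in\mathcal{H}$. The frame operator is $S_\varphi f=\sum_{i\in I}\langle f,\varphi_i\rangle\varphi_i$ (bounded, invertible, self-adjoint), and for $J\subseteq I$, $S_{\varphi_J}f=\sum_{i\in J}\langle f,\varphi_i\rangle\varphi_i$. $I_{\mathcal{H}}$ is the identity operator and $\ge$ is the usual order on self-adjoint operators. Two frames $\{\varphi_i\}_{i\in I}$ and $\{\psi_i\}_{i\in I}$ are woven if there are constants $0<A\le B<\infty$ such that for every $J\subseteq I$ the family $\{\varphi_i\}_{i\in J}\cup\{\psi_i\}_{i\in J^c}$ (with $J^c=I\setminus J$, counted with indices) is a frame for $\mathcal{H}$ with bounds $A$ and $B$. For subspaces $W_1,W_2$ of $\mathcal{H}$, let $\mathcal{S}_{W_k}$ be the set of unit vectors in $W_k$, and put $d_{W_1}(W_2)=\inf\{\Vert f-g\Vert: f\in W_1,\ g\in\mathcal{S}_{W_2}\}$, $d_{W_2}(W_1)=\inf\{\Vert f-g\Vert: f\in\mathcal{S}_{W_1},\ g\in W_2\}$ (with $\inf\emptyset=+\infty$), and $d(W_1,W_2)=\min\{d_{W_1}(W_2),d_{W_2}(W_1)\}$. For $J\subseteq I$, $d_{\varphi_J,\psi_{J^c}}:=d(\overline{\mathrm{span}}\{\varphi_i\}_{i\in J},\overline{\mathrm{span}}\{\psi_i\}_{i\in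 J^c})$. *)

theory Defs
  imports "HOL-Analysis.Analysis"
begin

text \<open>
  The scalar field of a Hilbert space is \<open>\<real>\<close> or \<open>\<complex>\<close>. Both are treated uniformly through the following
  class; by the Gelfand--Mazur theorem they are, up to isomorphism, its only instances
  (with \<open>sconj\<close> the identity and complex conjugation, respectively).
\<close>

class rc_field = real_normed_field +
  fixes sconj :: "'a \<Rightarrow> 'a"
  assumes sconj_add: "sconj (x + y) = sconj x + sconj y"
    and sconj_mult: "sconj (x * y) = sconj x * sconj y"
    and sconj_sconj: "sconj (sconj x) = x"
    and mult_sconj: "x * sconj x = (norm x)\<^sup>2 *\<^sub>R 1"

instantiation real :: rc_field
begin
definition sconj_real :: "real \<Rightarrow> real" where "sconj_real x = x"
instance by standard (simp_all add: sconj_real_def power2_eq_square)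
end

instantiation complex :: rc_field
begin
definition sconj_complex :: "complex \<Rightarrow> complex" where "sconj_complex = cnj"
instance by standard (simp_all add: sconj_complex_def scaleR_conv_of_real complex_norm_square
    del: of_real_power)
end

text \<open>
  A Hilbert space over \<open>'k\<close>. The type class \<open>banach\<close> supplies norm, topology, completeness and the
  scalar multiplication by reals; \<open>scl\<close> is the scalar multiplication by \<open>'k\<close>. The inner product
  is linear in the first argument.
\<close>

locale hilbert_space = vector_space scl
  for scl :: "'k::rc_field \<Rightarrow> 'h::banach \<Rightarrow> 'h" +
  fixes ip :: "'h \<Rightarrow> 'h \<Rightarrow> 'k"
  assumes scl_of_real: "scl (of_real r) x = r *\<^sub>R x"
    and ip_add_left: "ip (x + y) z = ip x z + ip y z"
    and ip_scl_left: "ip (scl c x) y = c * ip x y"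
    and ip_commute: "ip y x = sconj (ip x y)"
    and ip_self: "ip x x = of_real ((norm x)\<^sup>2)"

lemma hilbert_space_inner:
  "hilbert_space scaleR (inner :: 'h::{real_inner,banach} \<Rightarrow> 'h \<Rightarrow> real)"
  by unfold_locales
     (auto simp: algebra_simps sconj_real_def inner_commute power2_norm_eq_inner)

lemma hilbert_space_complex:
  "hilbert_space (*) (\<lambda>x y :: complex. x * cnj y)"
  by unfold_locales
     (auto simp: algebra_simps sconj_complex_def scaleR_conv_of_real simp flip: complex_norm_square)

definition separable :: "'h::topological_space set \<Rightarrow> bool" where
  "separable X \<longleftrightarrow> (\<exists>D. countable D \<and> D \<subseteq> X \<and> X \<subseteq> closure D)"

text \<open>
  Families are functions restricted to an index set. In \<open>frame_bounds\<close> summability has to be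
  demanded separately, because \<open>infsum\<close> of a divergent family is \<open>0\<close>.
\<close>

definition frame_bounds ::
    "('h::banach \<Rightarrow> 'h \<Rightarrow> 'k::rc_field) \<Rightarrow> 'i set \<Rightarrow> ('i \<Rightarrow> 'h) \<Rightarrow> real \<Rightarrow> real \<Rightarrow> bool" where
  "frame_bounds ip I \<phi> A B \<longleftrightarrow> 0 < A \<and> A \<le> B \<and>
     (\<forall>f. (\<lambda>i. (norm (ip f (\<phi> i)))\<^sup>2) summable_on I \<and>
          A * (norm f)\<^sup>2 \<le> (\<Sum>\<^sub>\<infinity>i\<in>I. (norm (ip f (\<phi> i)))\<^sup>2) \<and>
          (\<Sum>\<^sub>\<infinity>i\<in>I. (norm (ip f (\<phi> i)))\<^sup>2) \<le> B * (norm f)\<^sup>2)"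

definition is_frame ::
    "('h::banach \<Rightarrow> 'h \<Rightarrow> 'k::rc_field) \<Rightarrow> 'i set \<Rightarrow> ('i \<Rightarrow> 'h) \<Rightarrow> bool" where
  "is_frame ip I \<phi> \<longleftrightarrow> (\<exists>A B. frame_bounds ip I \<phi> A B)"

definition frame_op ::
    "('k::rc_field \<Rightarrow> 'h::banach \<Rightarrow> 'h) \<Rightarrow> ('h \<Rightarrow> 'h \<Rightarrow> 'k) \<Rightarrow> 'i set \<Rightarrow> ('i \<Rightarrow> 'h) \<Rightarrow> 'h \<Rightarrow> 'h" where
  "frame_op scl ip J \<phi> f = (\<Sum>\<^sub>\<infinity>i\<in>J. scl (ip f (\<phi> i)) (\<phi> i))"

definition woven ::
    "('h::banach \<Rightarrow> 'h \<Rightarrow> 'k::rc_field) \<Rightarrow> 'i set \<Rightarrow> ('i \<Rightarrow> 'h) \<Rightarrow> ('i \<Rightarrow> 'h) \<Rightarrow> bool" where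
  "woven ip I \<phi> \<psi> \<longleftrightarrow>
     (\<exists>A B. \<forall>J\<subseteq>I. frame_bounds ip I (\<lambda>i. if i \<in> J then \<phi> i else \<psi> i) A B)"

definition closed_span ::
    "('k::rc_field \<Rightarrow> 'h::banach \<Rightarrow> 'h) \<Rightarrow> 'h set \<Rightarrow> 'h set" where
  "closed_span scl X = closure (module.span scl X)"

text \<open>
  Riesz basis: complete, and equivalent to the canonical basis of \<open>\<ell>\<^sup>2(I)\<close> on finitely supported
  coefficient families.
\<close>

definition riesz_basis ::
    "('k::rc_field \<Rightarrow> 'h::banach \<Rightarrow> 'h) \<Rightarrow> 'i set \<Rightarrow> ('i \<Rightarrow> 'h) \<Rightarrow> bool" where
  "riesz_basis scl I \<phi> \<longleftrightarrow> closed_span scl (\<phi> ` I) = UNIV \<and>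
     (\<exists>A B. 0 < A \<and> A \<le> B \<and>
        (\<forall>F c. finite F \<and> F \<subseteq> I \<longrightarrow>
           A * (\<Sum>i\<in>F. (norm (c i))\<^sup>2) \<le> (norm (\<Sum>i\<in>F. scl (c i) (\<phi> i)))\<^sup>2 \<and>
           (norm (\<Sum>i\<in>F. scl (c i) (\<phi> i)))\<^sup>2 \<le> B * (\<Sum>i\<in>F. (norm (c i))\<^sup>2)))"

text \<open>
  \<open>op_ge ip S T\<close> is the order \<open>S \<ge> T\<close> of self-adjoint operators; the existential expresses
  that the scalar \<open>\<langle>(S - T) f, f\<rangle>\<close> is a nonnegative real.
\<close>

definition op_ge ::
    "('h::banach \<Rightarrow> 'h \<Rightarrow> 'k::rc_field) \<Rightarrow> ('h \<Rightarrow> 'h) \<Rightarrow> ('h \<Rightarrow> 'h) \<Rightarrow> bool" where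
  "op_ge ip S T \<longleftrightarrow> (\<forall>f. \<exists>r\<ge>0. ip (S f - T f) f = of_real r)"

definition bounded_op ::
    "('k::rc_field \<Rightarrow> 'h::banach \<Rightarrow> 'h) \<Rightarrow> ('h \<Rightarrow> 'h) \<Rightarrow> bool" where
  "bounded_op scl T \<longleftrightarrow> bounded_linear T \<and> (\<forall>c x. T (scl c x) = scl c (T x))"

definition bounded_invertible_op ::
    "('k::rc_field \<Rightarrow> 'h::banach \<Rightarrow> 'h) \<Rightarrow> ('h \<Rightarrow> 'h) \<Rightarrow> bool" where
  "bounded_invertible_op scl T \<longleftrightarrow> bounded_op scl T \<and> bij T \<and> bounded_op scl (inv T)"

definition unit_vectors :: "'h::real_normed_vector set \<Rightarrow> 'h set" where
  "unit_vectors W = {f \<in> W. norm f = 1}"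

text \<open>Values in \<open>ereal\<close>, so that the infimum of the empty set is \<open>\<infinity>\<close>.\<close>

definition subspace_dist :: "'h::real_normed_vector set \<Rightarrow> 'h set \<Rightarrow> ereal" where
  "subspace_dist W1 W2 =
     min (INF (f, g) \<in> W1 \<times> unit_vectors W2. ereal (norm (f - g)))
         (INF (f, g) \<in> unit_vectors W1 \<times> W2. ereal (norm (f - g)))"

end

theory Submission
  imports Defs "HOL-Complex_Analysis.Great_Picard"
begin

text \<open>
  (i) Commutation of \<open>S\<close> with the rank-one operators \<open>S\<^bsub>{i}\<^esub>\<close> makes every \<open>\<phi>\<^sub>i\<close> an eigenvector of
  \<open>S\<close>. Hence \<open>S\<^sup>-\<^sup>1 \<phi>\<^sub>i = s\<^sub>i \<phi>\<^sub>i\<close>, where \<open>s\<^sub>i \<ge> 1\<close> by \<open>S\<^sup>-\<^sup>1 \<ge> I\<close> and the \<open>s\<^sub>i\<close> are bounded by the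
  lower frame bound, so replacing \<open>\<phi>\<^sub>i\<close> by \<open>S\<^sup>-\<^sup>1 \<phi>\<^sub>i\<close> can only enlarge the frame sums.

  (ii) For fixed \<open>J\<close>, expand \<open>x = T\<^sub>1\<^sup>-\<^sup>1 f\<close> in the woven frame as \<open>y + z\<close> with \<open>y\<close> in the span of the
  \<open>\<phi>\<^sub>i\<close> and \<open>z\<close> in the span of the \<open>\<psi>\<^sub>i\<close>. The distance hypothesis bounds \<open>\<parallel>z\<parallel>\<close> by \<open>\<parallel>x\<parallel> / d\<close>, so in
  \<open>\<parallel>f\<parallel>\<^sup>2 = \<langle>T\<^sub>1 y + T\<^sub>2 z, f\<rangle> + \<langle>(T\<^sub>1 - T\<^sub>2) z, f\<rangle>\<close> the last term is at most \<open>q \<parallel>f\<parallel>\<^sup>2\<close> with \<open>q < 1\<close>, while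
  the first is controlled by the frame sum of \<open>f\<close>. The resulting lower bound depends on \<open>J\<close>.
  Uniformity in \<open>J\<close> is automatic: if unit vectors \<open>f\<^sub>n\<close> have frame sums tending to \<open>0\<close> along sets
  \<open>J\<^sub>n\<close>, pass to a subsequence with \<open>J\<^sub>n \<rightarrow> J\<close> and \<open>f\<^sub>n \<rightarrow> f\<close> weakly. The frame property for \<open>J\<close>
  forces \<open>f = 0\<close>, and then a gliding hump glues pieces of the \<open>J\<^sub>n\<close> to a single set whose weaving has no
  lower frame bound.
\<close>

section \<open>Unconditional summability and finite sums\<close>

text \<open>The Cauchy criterion for unconditional sums: finite sets containing \<open>F\<close> all
  have partial sums close to \<open>sum f F\<close>, so the net of partial sums is Cauchy and
  completeness applies.\<close>

lemma summable_on_small_tails: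
  fixes f :: "'i \<Rightarrow> 'b::banach"
  assumes "\<And>e. e > 0 \<Longrightarrow> \<exists>F. finite F \<and> F \<subseteq> A \<and> (\<forall>G. finite G \<and> G \<subseteq> A - F \<longrightarrow> norm (sum f G) < e)"
  shows "f summable_on A"
proof -
  have "\<exists>P. eventually P (finite_subsets_at_top A) \<and>
              (\<forall>F F'. P F \<and> P F' \<longrightarrow> dist (sum f F) (sum f F') < e)" if "e > 0" for e
  proof -
    have "0 < e / 2" using that by simp
    from assms[OF this] obtain F0 where F0: "finite F0" "F0 \<subseteq> A"
      and small: "\<And>G. finite G \<Longrightarrow> G \<subseteq> A - F0 \<Longrightarrow> norm (sum f G) < e / 2"
      by auto
    define P where "P F \<longleftrightarrow> finite F \<and> F0 \<subseteq> F \<and> F \<subseteq> A" for F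
    have near: "dist (sum f F) (sum f F0) < e / 2" if "P F" for F
      using small[of "F - F0"] that F0 by (auto simp: P_def dist_norm sum_diff)
    have "dist (sum f F) (sum f F') < e" if "P F" "P F'" for F F'
      using near[OF that(1)] near[OF that(2)] by metric
    moreover have "eventually P (finite_subsets_at_top A)"
      using F0 by (auto simp: P_def eventually_finite_subsets_at_top)
    ultimately show ?thesis by blast
  qed
  then have "cauchy_filter (filtermap (sum f) (finite_subsets_at_top A))"
    by (simp add: cauchy_filter_metric_filtermap)
  moreover have "complete (UNIV::'b set)"
    by (meson Cauchy_convergent UNIV_I complete_def convergent_def)
  ultimately obtain L where "(sum f \<longlongrightarrow> L) (finite_subsets_at_top A)"
    using complete_uniform[where S=UNIV] by (force simp add: filterlim_def)
  then show ?thesis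
    using summable_on_def has_sum_def by blast
qed

text \<open>By nonnegativity, a finite set whose sum is within \<open>e / 2\<close> of the total
  leaves at most \<open>e / 2\<close> for any set disjoint from it.\<close>

lemma nonneg_summable_tail:
  fixes g :: "'i \<Rightarrow> real"
  assumes "g summable_on A" "\<And>i. i \<in> A \<Longrightarrow> 0 \<le> g i" "0 < e"
  obtains F where "finite F" "F \<subseteq> A" "\<And>G. finite G \<Longrightarrow> G \<subseteq> A - F \<Longrightarrow> sum g G < e"
proof -
  obtain F where F: "finite F" "F \<subseteq> A" "dist (sum g F) (infsum g A) \<le> e / 2"
    using has_sum_finite_approximation[OF has_sum_infsum[OF assms(1)], of "e / 2"] assms(3) by auto
  have "sum g G < e" if "finite G" "G \<subseteq> A - F" for G
  proof -
    have "sum g F + sum g G = sum g (F \<union> G)"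
      using F that by (intro sum.union_disjoint[symmetric]) auto
    also have "\<dots> \<le> infsum g A"
      using F that assms by (intro finite_sum_le_infsum) auto
    finally show ?thesis using F(3) assms(3) unfolding dist_real_def by linarith
  qed
  with F that show ?thesis by blast
qed

lemma nonneg_bounded_sums_summable:
  fixes g :: "'i \<Rightarrow> real"
  assumes "\<And>i. i \<in> A \<Longrightarrow> 0 \<le> g i" "\<And>F. finite F \<Longrightarrow> F \<subseteq> A \<Longrightarrow> sum g F \<le> C"
  shows "g summable_on A"
  using assms by (intro nonneg_bdd_above_summable_on) (auto intro!: bdd_aboveI2)

lemma norm_has_sum_le:
  fixes f :: "'i \<Rightarrow> 'b::real_normed_vector"
  assumes "(f has_sum x) A" "\<And>F. finite F \<Longrightarrow> F \<subseteq> A \<Longrightarrow> norm (sum f F) \<le> C"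
  shows "norm x \<le> C"
proof (rule tendsto_upperbound)
  show "((\<lambda>F. norm (sum f F)) \<longlongrightarrow> norm x) (finite_subsets_at_top A)"
    using assms(1) unfolding has_sum_def by (rule tendsto_norm)
  show "\<forall>\<^sub>F F in finite_subsets_at_top A. norm (sum f F) \<le> C"
    using assms(2) by (intro eventually_finite_subsets_at_top_weakI)
qed simp

lemma has_sum_in_closed_span:
  fixes scl :: "'k::rc_field \<Rightarrow> 'h::banach \<Rightarrow> 'h"
  assumes "module scl" "((\<lambda>i. scl (c i) (v i)) has_sum x) J"
  shows "x \<in> closed_span scl (v ` J)"
  unfolding closed_span_def
proof (rule Lim_in_closed_set)
  show "((\<lambda>F. \<Sum>i\<in>F. scl (c i) (v i)) \<longlongrightarrow> x) (finite_subsets_at_top J)"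
    using assms(2) unfolding has_sum_def .
  have "(\<Sum>i\<in>F. scl (c i) (v i)) \<in> module.span scl (v ` J)" if "finite F" "F \<subseteq> J" for F
    using that assms(1)
    by (intro module.span_sum module.span_scale module.span_base) auto
  then show "\<forall>\<^sub>F F in finite_subsets_at_top J.
      (\<Sum>i\<in>F. scl (c i) (v i)) \<in> closure (module.span scl (v ` J))"
    by (intro eventually_finite_subsets_at_top_weakI) (use closure_subset in blast)
qed auto

lemma norm_sum_mult_sq_le:
  fixes a b :: "'i \<Rightarrow> 'k::real_normed_field"
  shows "(norm (\<Sum>i\<in>F. a i * b i))\<^sup>2 \<le> (\<Sum>i\<in>F. (norm (a i))\<^sup>2) * (\<Sum>i\<in>F. (norm (b i))\<^sup>2)"
proof -
  have "norm (\<Sum>i\<in>F. a i * b i) \<le> (\<Sum>i\<in>F. norm (a i) * norm (b i))"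
    by (rule order_trans[OF norm_sum]) (simp add: norm_mult)
  then have "(norm (\<Sum>i\<in>F. a i * b i))\<^sup>2 \<le> (\<Sum>i\<in>F. norm (a i) * norm (b i))\<^sup>2"
    by (intro power_mono) auto
  also have "\<dots> \<le> (\<Sum>i\<in>F. (norm (a i))\<^sup>2) * (\<Sum>i\<in>F. (norm (b i))\<^sup>2)"
    by (rule Cauchy_Schwarz_ineq_sum)
  finally show ?thesis .
qed

section \<open>Conjugation and real coordinates of scalars\<close>

lemma sconj_0 [simp]: "sconj (0::'k::rc_field) = 0"
  using sconj_add[of "0::'k" 0] by simp

lemma norm_sconj [simp]: "norm (sconj (x::'k::rc_field)) = norm x"
proof (cases "x = 0")
  case False
  have "norm x * norm (sconj x) = norm x * norm x"
    using arg_cong[OF mult_sconj[of x], of norm] by (simp add: norm_mult power2_eq_square)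
  then show ?thesis using False by simp
qed simp

lemma mult_sconj_of_real: "(x::'k::rc_field) * sconj x = of_real ((norm x)\<^sup>2)"
  using mult_sconj[of x] by (simp add: of_real_def)

lemma sconj_of_real [simp]: "sconj (of_real r :: 'k::rc_field) = of_real r"
proof (cases "r = 0")
  case False
  have "of_real r * sconj (of_real r :: 'k) = of_real r * of_real r"
    using mult_sconj_of_real[of "of_real r :: 'k"] by (simp add: power2_eq_square)
  then show ?thesis using False by (metis mult_left_cancel of_real_eq_0_iff)
qed simp

lemma sconj_minus: "sconj (- x :: 'k::rc_field) = - sconj x"
  using sconj_add[of x "-x"] by (simp add: eq_neg_iff_add_eq_0 add.commute)

lemma sconj_diff: "sconj (x - y :: 'k::rc_field) = sconj x - sconj y"
  using sconj_add[of x "-y"] by (simp add: sconj_minus)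

lemma sconj_divide: "y \<noteq> 0 \<Longrightarrow> sconj (x / y :: 'k::rc_field) = sconj x / sconj y"
  using sconj_mult[of "x / y" y] by (metis nonzero_eq_divide_eq norm_eq_zero norm_sconj)

text \<open>For such \<open>x\<close> the law \<open>mult_sconj\<close> says that the square of
  \<open>x\<close> equals the square of \<open>norm x\<close>, and this difference of squares
  factors in a field.\<close>

lemma self_conj_real:
  fixes x :: "'k::rc_field"
  assumes "sconj x = x"
  obtains a :: real where "x = of_real a" "\<bar>a\<bar> = norm x"
proof -
  have "(x - of_real (norm x)) * (x + of_real (norm x)) = 0"
    using mult_sconj_of_real[of x] assms by (simp add: algebra_simps power2_eq_square)
  then consider "x = of_real (norm x)" | "x = of_real (- norm x)"
    by (auto simp: eq_neg_iff_add_eq_0)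
  then show ?thesis using that by cases (metis abs_norm_cancel abs_minus_cancel)+
qed

text \<open>The scalars have dimension at most two over the reals, so bounded sequences of
  scalars can be handled through two real coordinates.\<close>

lemma rc_field_coordinates:
  obtains z :: "'k::rc_field" and a b :: "'k \<Rightarrow> real"
  where "\<And>x. x = of_real (a x) + of_real (b x) * z" "\<And>x. \<bar>a x\<bar> \<le> norm x" "\<And>x. \<bar>b x\<bar> \<le> norm x"
proof -
  have half: "sconj (x / 2) = sconj x / 2" for x :: 'k
    using sconj_divide[of 2 x] sconj_of_real[of 2, where 'k='k] by simp
  \<comment> \<open>The analogue of real and imaginary parts: \<open>p\<close> is self-conjugate,
    hence real by \<open>self_conj_real\<close>, and \<open>q\<close> is skew.\<close>
  have split: "\<exists>p q. x = p + q \<and> sconj p = p \<and> sconj q = - q \<and> norm p \<le> norm x \<and> norm q \<le> norm x"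
    for x :: 'k
  proof (intro exI conjI)
    show "x = (x + sconj x) / 2 + (x - sconj x) / 2" by (simp add: field_simps)
    show "sconj ((x + sconj x) / 2) = (x + sconj x) / 2"
      by (simp add: half sconj_add sconj_sconj add.commute)
    show "sconj ((x - sconj x) / 2) = - ((x - sconj x) / 2)"
      by (simp add: half sconj_diff sconj_sconj field_simps)
    show "norm ((x + sconj x) / 2) \<le> norm x"
      using norm_triangle_ineq[of x "sconj x"] by (simp add: norm_divide)
    show "norm ((x - sconj x) / 2) \<le> norm x"
      using norm_triangle_ineq4[of x "sconj x"] by (simp add: norm_divide)
  qed
  \<comment> \<open>The quotient of two skew scalars is self-conjugate, hence real, so the skew
    scalars form at most a real line. A nonzero one, normalised, serves as \<open>z\<close>; if
    there is none, \<open>z = 0\<close>.\<close>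
  obtain z :: 'k where z: "\<And>q. sconj q = - q \<Longrightarrow> \<exists>b. q = of_real b * z \<and> \<bar>b\<bar> = norm q"
  proof (cases "\<exists>y::'k. y \<noteq> 0 \<and> sconj y = - y")
    case True
    then obtain y :: 'k where y: "y \<noteq> 0" "sconj y = - y" by blast
    have "\<exists>b. q = of_real b * (y / of_real (norm y)) \<and> \<bar>b\<bar> = norm q" if "sconj q = - q" for q
    proof -
      have "sconj (q / y) = q / y" using y that by (simp add: sconj_divide)
      then obtain r where r: "q / y = of_real r" "\<bar>r\<bar> = norm (q / y)"
        using self_conj_real by metis
      then have "q = of_real (r * norm y) * (y / of_real (norm y))" "\<bar>r * norm y\<bar> = norm q"
        using y by (auto simp: nonzero_divide_eq_eq abs_mult norm_divide norm_mult)
      then show ?thesis by blast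
    qed
    then show ?thesis using that by blast
  next
    case False
    show ?thesis by (rule that[of 0]) (use False in \<open>auto intro!: exI[of _ 0]\<close>)
  qed
  have "\<exists>a b. x = of_real a + of_real b * z \<and> \<bar>a\<bar> \<le> norm x \<and> \<bar>b\<bar> \<le> norm x" for x
    by (metis split self_conj_real z)
  then show ?thesis using that by metis
qed

section \<open>Bessel families\<close>

text \<open>Stated through finite partial sums, so that summability is a consequence and not a side
  condition. The clause \<open>0 \<le> B\<close> matters on the zero space, where the inequalities
  leave the sign of \<open>B\<close> open.\<close>

definition bessel ::
    "('h::banach \<Rightarrow> 'h \<Rightarrow> 'k::rc_field) \<Rightarrow> 'i set \<Rightarrow> ('i \<Rightarrow> 'h) \<Rightarrow> real \<Rightarrow> bool" where
  "bessel ip I v B \<longleftrightarrow> 0 \<le> B \<and>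
     (\<forall>f F. finite F \<longrightarrow> F \<subseteq> I \<longrightarrow> (\<Sum>i\<in>F. (norm (ip f (v i)))\<^sup>2) \<le> B * (norm f)\<^sup>2)"

lemma besselD: "bessel ip I v B \<Longrightarrow> finite F \<Longrightarrow> F \<subseteq> I \<Longrightarrow> (\<Sum>i\<in>F. (norm (ip f (v i)))\<^sup>2) \<le> B * (norm f)\<^sup>2"
  by (simp add: bessel_def)

lemma bessel_summable: "bessel ip I v B \<Longrightarrow> (\<lambda>i. (norm (ip f (v i)))\<^sup>2) summable_on I"
  by (rule nonneg_bounded_sums_summable[where C="B * (norm f)\<^sup>2"]) (auto simp: bessel_def)

lemma frame_bounds_bessel: "frame_bounds ip I v A B \<Longrightarrow> bessel ip I v B"
  unfolding frame_bounds_def bessel_def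
  by (auto intro: order_trans[OF finite_sum_le_infsum])

text \<open>The \<open>max\<close> secures the order of the two bounds also on the zero space, where
  the estimates do not force \<open>A \<le> B\<close>.\<close>

lemma frame_boundsI:
  assumes "0 < A" "bessel ip I v B"
    and "\<And>f. A * (norm f)\<^sup>2 \<le> (\<Sum>\<^sub>\<infinity>i\<in>I. (norm (ip f (v i)))\<^sup>2)"
  shows "frame_bounds ip I v A (max A B)"
proof -
  have "(\<Sum>\<^sub>\<infinity>i\<in>I. (norm (ip f (v i)))\<^sup>2) \<le> max A B * (norm f)\<^sup>2" for f
    by (intro infsum_le_finite_sums[OF bessel_summable[OF assms(2)]]
        order_trans[OF besselD[OF assms(2)]] mult_right_mono) auto
  then show ?thesis
    using assms bessel_summable[OF assms(2)] by (auto simp: frame_bounds_def)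
qed

section \<open>Inner product and synthesis of series\<close>

context hilbert_space
begin

lemma ip_add_right: "ip x (y + z) = ip x y + ip x z"
  by (metis ip_commute ip_add_left sconj_add)

lemma ip_scl_right: "ip x (scl c y) = sconj c * ip x y"
  by (metis ip_commute ip_scl_left sconj_mult)

lemma norm_ip_commute: "norm (ip x y) = norm (ip y x)"
  by (metis ip_commute norm_sconj)

lemma ip_0_left [simp]: "ip 0 y = 0"
  using ip_add_left[of 0 0 y] by simp

lemma ip_0_right [simp]: "ip y 0 = 0"
  using ip_add_right[of y 0 0] by simp

lemma ip_minus_left: "ip (- x) y = - ip x y"
  using ip_add_left[of x "-x" y] by (simp add: eq_neg_iff_add_eq_0 add.commute)

lemma ip_diff_left: "ip (x - y) z = ip x z - ip y z"
  using ip_add_left[of x "-y" z] by (simp add: ip_minus_left)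

lemma ip_diff_right: "ip z (x - y) = ip z x - ip z y"
  by (metis ip_commute ip_diff_left sconj_diff)

lemma ip_sum_left: "ip (\<Sum>i\<in>F. f i) y = (\<Sum>i\<in>F. ip (f i) y)"
  by (induction F rule: infinite_finite_induct) (auto simp: ip_add_left)

lemma ip_scaleR_left: "ip (r *\<^sub>R x) y = r *\<^sub>R ip x y"
  by (metis scl_of_real ip_scl_left scaleR_conv_of_real)

text \<open>The type class makes the norm compatible with real scalars only; for \<open>'k\<close>
  this comes from expanding \<open>ip (scl c x) (scl c x)\<close>.\<close>

lemma norm_scl: "norm (scl c x) = norm c * norm x"
proof -
  have "(of_real ((norm (scl c x))\<^sup>2) :: 'k) = of_real ((norm c * norm x)\<^sup>2)"
    unfolding ip_self[symmetric] ip_scl_left ip_scl_right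
    by (simp add: ip_self power_mult_distrib flip: mult.assoc mult_sconj_of_real of_real_power)
  then show ?thesis by (metis of_real_eq_iff power2_eq_iff_nonneg norm_ge_zero mult_nonneg_nonneg)
qed

lemma Cauchy_Schwarz: "norm (ip x y) \<le> norm x * norm y"
proof (cases "y = 0")
  case False
  \<comment> \<open>\<open>c\<close> is the coefficient of the orthogonal projection of
    \<open>x\<close> onto the line through \<open>y\<close>; the squared norm of the remainder is
    nonnegative.\<close>
  define p c where "p = ip x y" and "c = p / of_real ((norm y)\<^sup>2)"
  have c: "c * of_real ((norm y)\<^sup>2) = p" using False by (simp add: c_def)
  have "(of_real ((norm (x - scl c y))\<^sup>2) :: 'k) =
      ip x x - sconj c * p - c * sconj p + c * (sconj c * ip y y)"
    unfolding ip_self[symmetric] p_def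
    by (simp add: ip_commute[where x=x and y=y] ip_diff_left ip_diff_right ip_scl_left ip_scl_right algebra_simps)
  also have "\<dots> = ip x x - c * sconj p"
    unfolding ip_self[of y] using c by (simp add: algebra_simps)
  also have "c * sconj p = of_real ((norm p)\<^sup>2 / (norm y)\<^sup>2)"
    by (simp add: c_def mult_sconj_of_real)
  finally have "(norm (x - scl c y))\<^sup>2 = (norm x)\<^sup>2 - (norm p)\<^sup>2 / (norm y)\<^sup>2"
    unfolding ip_self by (metis of_real_diff of_real_eq_iff)
  then have "(norm p)\<^sup>2 / (norm y)\<^sup>2 \<le> (norm x)\<^sup>2"
    by (smt (verit) zero_le_power2)
  then have "(norm p)\<^sup>2 \<le> (norm x * norm y)\<^sup>2"
    using False by (simp add: field_simps power_mult_distrib)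
  then show ?thesis unfolding p_def by (rule power2_le_imp_le) simp
qed simp

lemma bounded_linear_ip: "bounded_linear (\<lambda>x. ip x y)"
  by (rule bounded_linear_intro[where K="norm y"])
    (auto simp: ip_add_left ip_scaleR_left Cauchy_Schwarz)

lemma bessel_norm_le:
  assumes "bessel ip I v B" "i \<in> I"
  shows "(norm (ip f (v i)))\<^sup>2 \<le> B * (norm f)\<^sup>2"
  using besselD[OF assms(1), of "{i}"] assms(2) by simp

text \<open>Duality: for the synthesised vector \<open>x\<close>, \<open>ip x x\<close> pairs the
  coefficients with the numbers \<open>ip (v i) x\<close>. Cauchy-Schwarz and the Bessel inequality
  at \<open>x\<close> itself leave a factor \<open>(norm x)^2\<close> to cancel.\<close>

lemma synthesis_finite_bound:
  assumes "bessel ip I v B" "finite F" "F \<subseteq> I"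
  shows "(norm (\<Sum>i\<in>F. scl (c i) (v i)))\<^sup>2 \<le> B * (\<Sum>i\<in>F. (norm (c i))\<^sup>2)"
proof -
  define x where "x = (\<Sum>i\<in>F. scl (c i) (v i))"
  have "((norm x)\<^sup>2)\<^sup>2 = (norm (ip x x))\<^sup>2" by (simp add: ip_self norm_power)
  also have "ip x x = (\<Sum>i\<in>F. c i * ip (v i) x)"
    unfolding x_def ip_sum_left ip_scl_left ..
  also have "(norm \<dots>)\<^sup>2 \<le> (\<Sum>i\<in>F. (norm (c i))\<^sup>2) * (\<Sum>i\<in>F. (norm (ip (v i) x))\<^sup>2)"
    by (rule norm_sum_mult_sq_le)
  also have "\<dots> \<le> (\<Sum>i\<in>F. (norm (c i))\<^sup>2) * (B * (norm x)\<^sup>2)"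
    using besselD[OF assms] by (intro mult_left_mono sum_nonneg) (simp_all add: norm_ip_commute[of _ x])
  finally have "(norm x)\<^sup>2 * (norm x)\<^sup>2 \<le> (B * (\<Sum>i\<in>F. (norm (c i))\<^sup>2)) * (norm x)\<^sup>2"
    by (simp add: power2_eq_square mult_ac)
  moreover have "0 \<le> B * (\<Sum>i\<in>F. (norm (c i))\<^sup>2)"
    using assms(1) by (simp add: bessel_def sum_nonneg)
  ultimately show ?thesis
    unfolding x_def[symmetric]
    by (cases "x = 0") (simp, rule mult_right_le_imp_le[where c="(norm x)\<^sup>2"], simp_all)
qed

text \<open>The converse duality: with the coefficients \<open>ip f (v i)\<close> the sum
  \<open>S\<close> equals \<open>ip x f\<close>, while the hypothesis bounds
  \<open>(norm x)^2\<close> by \<open>B * S\<close>, so one factor \<open>S\<close> cancels.\<close>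

lemma besselI_synthesis:
  assumes "0 \<le> B"
    and bd: "\<And>F c. finite F \<Longrightarrow> F \<subseteq> I \<Longrightarrow>
        (norm (\<Sum>i\<in>F. scl (c i) (v i)))\<^sup>2 \<le> B * (\<Sum>i\<in>F. (norm (c i))\<^sup>2)"
  shows "bessel ip I v B"
  unfolding bessel_def
proof (intro conjI allI impI)
  fix f F assume F: "finite F" "F \<subseteq> I"
  define S where "S = (\<Sum>i\<in>F. (norm (ip f (v i)))\<^sup>2)"
  define x where "x = (\<Sum>i\<in>F. scl (ip f (v i)) (v i))"
  have "ip x f = (\<Sum>i\<in>F. ip f (v i) * sconj (ip f (v i)))"
    unfolding x_def ip_sum_left ip_scl_left by (simp flip: ip_commute)
  also have "\<dots> = of_real S" by (simp add: S_def mult_sconj_of_real)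
  finally have "\<bar>S\<bar> \<le> norm x * norm f" using Cauchy_Schwarz[of x f] by simp
  then have "S * S \<le> (norm x)\<^sup>2 * (norm f)\<^sup>2"
    using power_mono[of "\<bar>S\<bar>" "norm x * norm f" 2] by (simp add: power_mult_distrib power2_eq_square mult_ac)
  also have "\<dots> \<le> (B * S) * (norm f)\<^sup>2"
    unfolding x_def S_def using F by (intro mult_right_mono bd) auto
  finally have "S * S \<le> (B * (norm f)\<^sup>2) * S" by (simp add: mult_ac)
  moreover have "0 \<le> S" by (simp add: S_def sum_nonneg)
  ultimately show "S \<le> B * (norm f)\<^sup>2"
    using assms(1) by (cases "S = 0") auto
qed (rule assms)

lemma synthesis_summable:
  assumes "bessel ip I v B" "(\<lambda>i. (norm (c i))\<^sup>2) summable_on I"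
  shows "(\<lambda>i. scl (c i) (v i)) summable_on I"
proof (rule summable_on_small_tails)
  fix e :: real assume e: "0 < e"
  have B: "0 \<le> B" using assms(1) by (simp add: bessel_def)
  \<comment> \<open>Dividing by \<open>B + 1\<close> and not by \<open>B\<close> covers the case
    \<open>B = 0\<close>.\<close>
  obtain F where F: "finite F" "F \<subseteq> I"
    and small: "\<And>G. finite G \<Longrightarrow> G \<subseteq> I - F \<Longrightarrow> (\<Sum>i\<in>G. (norm (c i))\<^sup>2) < e\<^sup>2 / (B + 1)"
    using nonneg_summable_tail[OF assms(2), of "e\<^sup>2 / (B + 1)"] B e by auto
  have "norm (\<Sum>i\<in>G. scl (c i) (v i)) < e" if G: "finite G" "G \<subseteq> I - F" for G
  proof -
    have "(norm (\<Sum>i\<in>G. scl (c i) (v i)))\<^sup>2 \<le> B * (\<Sum>i\<in>G. (norm (c i))\<^sup>2)"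
      using G by (intro synthesis_finite_bound[OF assms(1)]) auto
    also have "\<dots> \<le> (B + 1) * (\<Sum>i\<in>G. (norm (c i))\<^sup>2)"
      by (intro mult_right_mono sum_nonneg) auto
    also have "\<dots> < e\<^sup>2" using small[OF G] B by (simp add: field_simps)
    finally show ?thesis using e by (simp add: power2_less_imp_less)
  qed
  with F show "\<exists>F. finite F \<and> F \<subseteq> I \<and> (\<forall>G. finite G \<and> G \<subseteq> I - F \<longrightarrow> norm (\<Sum>i\<in>G. scl (c i) (v i)) < e)"
    by blast
qed

lemma synthesis_bound:
  assumes "bessel ip I v B" "\<And>F. finite F \<Longrightarrow> F \<subseteq> I \<Longrightarrow> (\<Sum>i\<in>F. (norm (c i))\<^sup>2) \<le> C"
    and "((\<lambda>i. scl (c i) (v i)) has_sum x) I"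
  shows "(norm x)\<^sup>2 \<le> B * C"
proof -
  have "norm x \<le> sqrt (B * C)"
  proof (rule norm_has_sum_le[OF assms(3)])
    fix F assume F: "finite F" "F \<subseteq> I"
    have "(norm (\<Sum>i\<in>F. scl (c i) (v i)))\<^sup>2 \<le> B * C"
      using assms(1) by (intro order_trans[OF synthesis_finite_bound[OF assms(1) F]] mult_left_mono assms(2) F)
        (simp add: bessel_def)
    then show "norm (\<Sum>i\<in>F. scl (c i) (v i)) \<le> sqrt (B * C)"
      by (rule real_le_rsqrt)
  qed
  then have "(norm x)\<^sup>2 \<le> (sqrt (B * C))\<^sup>2" by (intro power_mono) auto
  moreover have "0 \<le> B * C"
    using assms(1) assms(2)[of "{}"] by (simp add: bessel_def)
  ultimately show ?thesis by simp
qed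

end

section \<open>Termwise limits and extraction of subsequences\<close>

lemma has_sum_diff:
  fixes f g :: "'i \<Rightarrow> 'b::real_normed_vector"
  assumes "(f has_sum a) A" "(g has_sum b) A"
  shows "((\<lambda>i. f i - g i) has_sum (a - b)) A"
  using has_sum_add[OF assms(1), of "\<lambda>i. - g i" "- b"] assms(2) by (simp add: has_sum_uminus)

text \<open>Sequences bounded in \<ell>2 that vanish coordinatewise in the limit are weakly null:
  off a finite set carrying almost all of the square sum of \<open>d\<close>, Cauchy-Schwarz makes
  the pairing small uniformly in \<open>n\<close>; on that set finitely many terms tend to
  0.\<close>

lemma has_sum_mult_tendsto_0:
  fixes e :: "nat \<Rightarrow> 'i \<Rightarrow> 'k::real_normed_field"
  assumes s: "\<And>n. ((\<lambda>i. e n i * d i) has_sum s n) I"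
    and C: "\<And>n F. finite F \<Longrightarrow> F \<subseteq> I \<Longrightarrow> (\<Sum>i\<in>F. (norm (e n i))\<^sup>2) \<le> C"
    and d: "(\<lambda>i. (norm (d i))\<^sup>2) summable_on I"
    and e: "\<And>i. i \<in> I \<Longrightarrow> (\<lambda>n. e n i) \<longlonglongrightarrow> 0"
  shows "s \<longlonglongrightarrow> 0"
proof (rule tendstoI)
  fix r :: real assume r: "0 < r"
  have C0: "0 \<le> C" using C[of "{}"] by simp
  obtain F where F: "finite F" "F \<subseteq> I"
    and small: "\<And>G. finite G \<Longrightarrow> G \<subseteq> I - F \<Longrightarrow> (\<Sum>i\<in>G. (norm (d i))\<^sup>2) < (r / 2)\<^sup>2 / (C + 1)"
    using nonneg_summable_tail[OF d, of "(r / 2)\<^sup>2 / (C + 1)"] C0 r by auto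
  have bound: "norm (s n) \<le> (\<Sum>i\<in>F. norm (e n i * d i)) + r / 2" for n
  proof (rule norm_has_sum_le[OF s])
    fix G assume G: "finite G" "G \<subseteq> I"
    have "(norm (\<Sum>i\<in>G-F. e n i * d i))\<^sup>2
        \<le> (\<Sum>i\<in>G-F. (norm (e n i))\<^sup>2) * (\<Sum>i\<in>G-F. (norm (d i))\<^sup>2)"
      by (rule norm_sum_mult_sq_le)
    also have "\<dots> \<le> C * ((r / 2)\<^sup>2 / (C + 1))"
      using G C0 by (intro mult_mono sum_nonneg C less_imp_le[OF small]) auto
    also have "\<dots> \<le> (C + 1) * ((r / 2)\<^sup>2 / (C + 1))"
      using C0 by (intro mult_right_mono) auto
    also have "\<dots> = (r / 2)\<^sup>2" using C0 by simp
    finally have "norm (\<Sum>i\<in>G-F. e n i * d i) \<le> r / 2"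
      by (rule power2_le_imp_le) (use r in simp)
    moreover have "norm (\<Sum>i\<in>G\<inter>F. e n i * d i) \<le> (\<Sum>i\<in>F. norm (e n i * d i))"
      using F by (intro order_trans[OF norm_sum] sum_mono2) auto
    moreover have "(\<Sum>i\<in>G. e n i * d i) = (\<Sum>i\<in>G\<inter>F. e n i * d i) + (\<Sum>i\<in>G-F. e n i * d i)"
      using G(1) by (rule sum.Int_Diff)
    ultimately show "norm (\<Sum>i\<in>G. e n i * d i) \<le> (\<Sum>i\<in>F. norm (e n i * d i)) + r / 2"
      using norm_triangle_ineq[of "\<Sum>i\<in>G\<inter>F. e n i * d i" "\<Sum>i\<in>G-F. e n i * d i"] by simp
  qed
  have "(\<lambda>n. \<Sum>i\<in>F. norm (e n i * d i)) \<longlonglongrightarrow> (\<Sum>i\<in>F. norm (0 * d i))"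
    using e F by (intro tendsto_sum tendsto_norm tendsto_mult tendsto_const) auto
  then have "\<forall>\<^sub>F n in sequentially. (\<Sum>i\<in>F. norm (e n i * d i)) < r / 2"
    using r by (intro order_tendstoD(2)) auto
  then show "\<forall>\<^sub>F n in sequentially. dist (s n) 0 < r"
  proof eventually_elim
    case (elim n)
    then show ?case using bound[of n] by simp
  qed
qed

lemma of_bool_convergent_const:
  assumes "(\<lambda>n. of_bool (P n) :: real) \<longlonglongrightarrow> l"
  shows "\<exists>b. \<forall>\<^sub>F n in sequentially. P n = b"
proof
  have "\<forall>\<^sub>F n in sequentially. dist (of_bool (P n) :: real) l < 1 / 2"
    by (rule tendstoD[OF assms]) simp
  then show "\<forall>\<^sub>F n in sequentially. P n = (l > 1 / 2)"
  proof eventually_elim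
    case (elim n)
    then show ?case by (cases "P n") (simp_all add: dist_real_def abs_if split: if_splits)
  qed
qed

text \<open>One diagonal extraction serves scalars and sets together: over each \<open>i\<close> the
  bounded real family \<open>Y\<close> stores the two coordinates of \<open>X n i\<close> and the
  indicator of \<open>K n\<close>. A convergent sequence of zeros and ones is eventually
  constant.\<close>

lemma scalar_set_convergent_subsequence:
  fixes X :: "nat \<Rightarrow> 'i \<Rightarrow> 'k::rc_field" and K :: "nat \<Rightarrow> 'i set"
  assumes "countable I" "\<And>n i. i \<in> I \<Longrightarrow> norm (X n i) \<le> M"
  obtains k where "strict_mono (k :: nat \<Rightarrow> nat)"
    "\<And>i. i \<in> I \<Longrightarrow> \<exists>l. (\<lambda>n. X (k n) i) \<longlonglongrightarrow> l"
    "\<And>i. i \<in> I \<Longrightarrow> \<exists>b. \<forall>\<^sub>F n in sequentially. (i \<in> K (k n)) = b"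
proof -
  obtain z :: 'k and a b :: "'k \<Rightarrow> real" where
    z: "\<And>x. x = of_real (a x) + of_real (b x) * z"
    and ab: "\<And>x. \<bar>a x\<bar> \<le> norm x" "\<And>x. \<bar>b x\<bar> \<le> norm x"
    using rc_field_coordinates by metis
  define Y where "Y n = (\<lambda>(i, j). if j = (0::nat) then a (X n i) else if j = 1 then b (X n i)
      else of_bool (i \<in> K n))" for n
  have "norm (Y n p) \<le> max M 1" if "p \<in> I \<times> {0, 1, 2}" for n p
    using that order_trans[OF ab(1) assms(2)] order_trans[OF ab(2) assms(2)]
    by (auto simp: Y_def intro: max.coboundedI1)
  moreover have "countable (I \<times> {0, 1, 2::nat})" using assms(1) by auto
  ultimately obtain k where k: "strict_mono (k :: nat \<Rightarrow> nat)"
    "\<And>p. p \<in> I \<times> {0, 1, 2} \<Longrightarrow> \<exists>l. (\<lambda>n. Y (k n) p) \<longlonglongrightarrow> l"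
    using function_convergent_subsequence[of "I \<times> {0, 1, 2}" Y "max M 1"] by metis
  show ?thesis
  proof
    fix i assume i: "i \<in> I"
    obtain l m where "(\<lambda>n. a (X (k n) i)) \<longlonglongrightarrow> l" "(\<lambda>n. b (X (k n) i)) \<longlonglongrightarrow> m"
      using k(2)[of "(i, 0)"] k(2)[of "(i, 1)"] i by (auto simp: Y_def)
    then have "(\<lambda>n. of_real (a (X (k n) i)) + of_real (b (X (k n) i)) * z) \<longlonglongrightarrow> of_real l + of_real m * z"
      by (intro tendsto_intros)
    moreover have eq: "(\<lambda>n. X (k n) i) = (\<lambda>n. of_real (a (X (k n) i)) + of_real (b (X (k n) i)) * z)"
      by (rule ext) (rule z)
    ultimately have "(\<lambda>n. X (k n) i) \<longlonglongrightarrow> of_real l + of_real m * z"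
      by (subst eq)
    then show "\<exists>l. (\<lambda>n. X (k n) i) \<longlonglongrightarrow> l" by blast
    show "\<exists>b. \<forall>\<^sub>F n in sequentially. (i \<in> K (k n)) = b"
      using k(2)[of "(i, 2)"] i of_bool_convergent_const[of "\<lambda>n. i \<in> K (k n)"] by (auto simp: Y_def)
  qed (rule k)
qed

lemma bounded_linear_sconj: "bounded_linear (sconj :: 'k::rc_field \<Rightarrow> 'k)"
  by (rule bounded_linear_intro[where K=1])
    (simp_all add: sconj_add sconj_mult scaleR_conv_of_real)

section \<open>The frame operator and weak limits\<close>

context hilbert_space
begin

text \<open>The Bessel bound excludes the default value 0 that \<open>infsum\<close> gives to
  divergent families in \<open>frame_op\<close>.\<close>

lemma frame_op_has_sum:
  assumes "bessel ip I v B"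
  shows "((\<lambda>i. scl (ip x (v i)) (v i)) has_sum frame_op scl ip I v x) I"
  unfolding frame_op_def
  by (intro has_sum_infsum synthesis_summable[OF assms] bessel_summable[OF assms])

lemma synthesis_ip:
  assumes "((\<lambda>i. scl (c i) (v i)) has_sum x) I"
  shows "((\<lambda>i. c i * ip (v i) y) has_sum ip x y) I"
  using has_sum_bounded_linear[OF bounded_linear_ip assms, of y] by (simp add: ip_scl_left)

lemmas frame_op_ip = synthesis_ip[OF frame_op_has_sum]

lemma frame_op_ip_self:
  assumes "bessel ip I v B"
  shows "ip (frame_op scl ip I v x) x = of_real (\<Sum>\<^sub>\<infinity>i\<in>I. (norm (ip x (v i)))\<^sup>2)"
proof (rule has_sum_unique[OF frame_op_ip[OF assms]])
  have "((\<lambda>i. (of_real ((norm (ip x (v i)))\<^sup>2) :: 'k)) has_sum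
      of_real (\<Sum>\<^sub>\<infinity>i\<in>I. (norm (ip x (v i)))\<^sup>2)) I"
    by (intro has_sum_of_real has_sum_infsum bessel_summable[OF assms])
  moreover have "ip x (v i) * ip (v i) x = of_real ((norm (ip x (v i)))\<^sup>2)" for i
    using mult_sconj_of_real[of "ip x (v i)"] by (simp flip: ip_commute)
  ultimately show "((\<lambda>i. ip x (v i) * ip (v i) x) has_sum of_real (\<Sum>\<^sub>\<infinity>i\<in>I. (norm (ip x (v i)))\<^sup>2)) I"
    by simp
qed

lemma frame_op_diff:
  assumes "bessel ip I v B"
  shows "frame_op scl ip I v (x - y) = frame_op scl ip I v x - frame_op scl ip I v y"
proof (rule has_sum_unique[OF frame_op_has_sum[OF assms]])
  show "((\<lambda>i. scl (ip (x - y) (v i)) (v i)) has_sum frame_op scl ip I v x - frame_op scl ip I v y) I"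
    using has_sum_diff[OF frame_op_has_sum[OF assms, of x] frame_op_has_sum[OF assms, of y]]
    by (simp add: ip_diff_left scale_left_diff_distrib)
qed

lemma frame_op_scl:
  assumes "bessel ip I v B"
  shows "frame_op scl ip I v (scl c x) = scl c (frame_op scl ip I v x)"
proof (rule has_sum_unique[OF frame_op_has_sum[OF assms]])
  have "bounded_linear (scl c)"
    by (rule bounded_linear_intro[where K="norm c"])
      (simp_all add: scale_right_distrib norm_scl mult.commute flip: scl_of_real)
  from has_sum_bounded_linear[OF this frame_op_has_sum[OF assms, of x]]
  show "((\<lambda>i. scl (ip (scl c x) (v i)) (v i)) has_sum scl c (frame_op scl ip I v x)) I"
    by (simp add: ip_scl_left)
qed

lemma frame_op_selfadjoint:
  assumes "bessel ip I v B"
  shows "ip (frame_op scl ip I v x) y = ip x (frame_op scl ip I v y)"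
proof (rule has_sum_unique[OF frame_op_ip[OF assms]])
  have "((\<lambda>i. sconj (ip y (v i) * ip (v i) x)) has_sum sconj (ip (frame_op scl ip I v y) x)) I"
    by (intro has_sum_bounded_linear[OF bounded_linear_sconj] frame_op_ip[OF assms])
  then show "((\<lambda>i. ip x (v i) * ip (v i) y) has_sum ip x (frame_op scl ip I v y)) I"
    by (simp add: sconj_mult mult.commute flip: ip_commute)
qed

lemma frame_op_norm_le:
  assumes "bessel ip I v B"
  shows "norm (frame_op scl ip I v x) \<le> B * norm x"
proof -
  have "(norm (frame_op scl ip I v x))\<^sup>2 \<le> B * (B * (norm x)\<^sup>2)"
    using besselD[OF assms] by (rule synthesis_bound[OF assms _ frame_op_has_sum[OF assms]])
  then have "(norm (frame_op scl ip I v x))\<^sup>2 \<le> (B * norm x)\<^sup>2"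
    by (simp add: power_mult_distrib power2_eq_square mult_ac)
  then show ?thesis
    by (rule power2_le_imp_le) (use assms in \<open>simp add: bessel_def\<close>)
qed

lemma frame_op_lower:
  assumes "frame_bounds ip I v A B"
  shows "A * norm x \<le> norm (frame_op scl ip I v x)"
proof (cases "x = 0")
  case False
  have "A * (norm x)\<^sup>2 \<le> (\<Sum>\<^sub>\<infinity>i\<in>I. (norm (ip x (v i)))\<^sup>2)"
    using assms by (simp add: frame_bounds_def)
  also have "\<dots> \<le> norm (ip (frame_op scl ip I v x) x)"
    by (simp add: frame_op_ip_self[OF frame_bounds_bessel[OF assms]])
  also have "\<dots> \<le> norm (frame_op scl ip I v x) * norm x" by (rule Cauchy_Schwarz)
  finally show ?thesis using False by (simp add: power2_eq_square flip: mult.assoc)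
qed simp

text \<open>Since \<open>S\<close> is bounded above and below, \<open>y \<mapsto> y - (A / B\<^sup>2) (S y - x)\<close> is a contraction;
  its fixed point solves \<open>S y = x\<close>.\<close>

lemma frame_op_surj:
  assumes fb: "frame_bounds ip I v A B"
  shows "\<exists>y. frame_op scl ip I v y = x"
proof -
  note bes = frame_bounds_bessel[OF fb]
  let ?S = "frame_op scl ip I v"
  have AB: "0 < A" "A \<le> B" using fb by (auto simp: frame_bounds_def)
  \<comment> \<open>This \<open>t\<close> minimises \<open>1 - 2 * t * A + t^2 * B^2\<close>, and
    the minimum is the square of the contraction constant \<open>c\<close> below.\<close>
  define t where "t = A / B\<^sup>2"
  define c where "c = sqrt (1 - A\<^sup>2 / B\<^sup>2)"
  have AB2: "0 < A\<^sup>2 / B\<^sup>2" "A\<^sup>2 / B\<^sup>2 \<le> 1"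
    using AB by (auto simp: power_mono)
  have c: "0 \<le> c" "c < 1" "c\<^sup>2 = 1 - A\<^sup>2 / B\<^sup>2"
    using AB2 by (auto simp: c_def)
  have contr: "norm (y - t *\<^sub>R ?S y) \<le> c * norm y" for y
  proof -
    define a where "a = (\<Sum>\<^sub>\<infinity>i\<in>I. (norm (ip y (v i)))\<^sup>2)"
    have a: "ip (?S y) y = of_real a" "ip y (?S y) = of_real a"
      using frame_op_ip_self[OF bes, of y] frame_op_selfadjoint[OF bes, of y y] by (auto simp: a_def)
    have "(of_real ((norm (y - t *\<^sub>R ?S y))\<^sup>2) :: 'k) =
        of_real ((norm y)\<^sup>2 - 2 * t * a + t\<^sup>2 * (norm (?S y))\<^sup>2)"
      unfolding ip_self[symmetric] scl_of_real[symmetric] ip_diff_left ip_diff_right ip_scl_left ip_scl_right a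
      by (simp add: ip_self algebra_simps power2_eq_square)
    then have "(norm (y - t *\<^sub>R ?S y))\<^sup>2 = (norm y)\<^sup>2 - 2 * t * a + t\<^sup>2 * (norm (?S y))\<^sup>2"
      by (simp only: of_real_eq_iff)
    also have "\<dots> \<le> (norm y)\<^sup>2 - 2 * t * (A * (norm y)\<^sup>2) + t\<^sup>2 * (B * norm y)\<^sup>2"
    proof (intro add_mono diff_mono mult_left_mono power_mono frame_op_norm_le[OF bes])
      show "A * (norm y)\<^sup>2 \<le> a" using fb by (simp add: frame_bounds_def a_def)
    qed (use AB in \<open>auto simp: t_def\<close>)
    also have "\<dots> = (c * norm y)\<^sup>2"
      using AB unfolding power_mult_distrib c(3) t_def
      by (simp add: field_simps power2_eq_square)
    finally show ?thesis by (rule power2_le_imp_le) (simp add: c)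
  qed
  have "\<exists>!y. y - t *\<^sub>R (?S y - x) = y"
  proof (rule banach_fix_type[OF c(1,2)], intro allI)
    fix y z
    have "(y - t *\<^sub>R (?S y - x)) - (z - t *\<^sub>R (?S z - x)) = (y - z) - t *\<^sub>R ?S (y - z)"
      by (simp add: frame_op_diff[OF bes] algebra_simps)
    then show "dist (y - t *\<^sub>R (?S y - x)) (z - t *\<^sub>R (?S z - x)) \<le> c * dist y z"
      using contr[of "y - z"] by (simp only: dist_norm)
  qed
  then show ?thesis using AB by (auto simp: t_def)
qed

text \<open>The coefficients are the canonical ones, \<open>ip y (v i)\<close> with \<open>y\<close>
  the preimage of \<open>x\<close> under the frame operator; the lower frame bound gives
  \<open>norm y \<le> norm x / A\<close>.\<close>

lemma frame_expansion:
  assumes fb: "frame_bounds ip I v A B"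
  obtains c where "((\<lambda>i. scl (c i) (v i)) has_sum x) I"
    "\<And>F. finite F \<Longrightarrow> F \<subseteq> I \<Longrightarrow> (\<Sum>i\<in>F. (norm (c i))\<^sup>2) \<le> B / A\<^sup>2 * (norm x)\<^sup>2"
proof -
  note bes = frame_bounds_bessel[OF fb]
  have AB: "0 < A" "A \<le> B" using fb by (auto simp: frame_bounds_def)
  obtain y where y: "frame_op scl ip I v y = x" using frame_op_surj[OF fb] by blast
  show ?thesis
  proof
    show "((\<lambda>i. scl (ip y (v i)) (v i)) has_sum x) I"
      using frame_op_has_sum[OF bes, of y] y by simp
    fix F assume "finite F" "F \<subseteq> I"
    then have "(\<Sum>i\<in>F. (norm (ip y (v i)))\<^sup>2) \<le> B * (norm y)\<^sup>2" by (rule besselD[OF bes])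
    also have "(norm y)\<^sup>2 \<le> (norm x / A)\<^sup>2"
      using frame_op_lower[OF fb, of y] y AB by (intro power_mono) (auto simp: field_simps)
    finally show "(\<Sum>i\<in>F. (norm (ip y (v i)))\<^sup>2) \<le> B / A\<^sup>2 * (norm x)\<^sup>2"
      using AB by (simp add: power_divide)
  qed
qed

text \<open>The frame operator, being self-adjoint and invertible, takes the place of the
  Riesz representation theorem here.\<close>

lemma frame_weak_limit:
  assumes fb: "frame_bounds ip I v A B"
    and f: "\<And>n. norm (f n) \<le> 1"
    and a: "\<And>i. i \<in> I \<Longrightarrow> (\<lambda>n. ip (f n) (v i)) \<longlonglongrightarrow> a i"
  obtains g where "\<And>x. (\<lambda>n. ip (f n) x) \<longlonglongrightarrow> ip g x"
proof -
  note bes = frame_bounds_bessel[OF fb]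
  let ?S = "frame_op scl ip I v"
  have B: "0 \<le> B" using bes by (simp add: bessel_def)
  have bf: "(\<Sum>i\<in>F. (norm (ip (f n) (v i)))\<^sup>2) \<le> B" if "finite F" "F \<subseteq> I" for F n
    using besselD[OF bes that, of "f n"] mult_left_le[OF power_le_one[OF norm_ge_zero f] B, of n 2] by simp
  have ba: "(\<Sum>i\<in>F. (norm (a i))\<^sup>2) \<le> B" if F: "finite F" "F \<subseteq> I" for F
  proof (rule LIMSEQ_le_const2)
    show "(\<lambda>n. \<Sum>i\<in>F. (norm (ip (f n) (v i)))\<^sup>2) \<longlonglongrightarrow> (\<Sum>i\<in>F. (norm (a i))\<^sup>2)"
      using F a by (intro tendsto_sum tendsto_power tendsto_norm) auto
  qed (use bf[OF F] in blast)
  have "(\<lambda>i. scl (a i) (v i)) summable_on I"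
    by (intro synthesis_summable[OF bes] nonneg_bounded_sums_summable[where C=B] ba) auto
  then obtain h where h: "((\<lambda>i. scl (a i) (v i)) has_sum h) I" by (auto simp: summable_on_def)
  \<comment> \<open>A weak limit \<open>g\<close> must satisfy \<open>ip g (v i) = a i\<close>, so
    \<open>?S g\<close> has to be the synthesis of \<open>a\<close>.\<close>
  obtain g where g: "?S g = h" using frame_op_surj[OF fb] by blast
  show ?thesis
  proof
    fix x
    \<comment> \<open>Moving \<open>?S\<close> across the inner product expresses
      \<open>ip (f n) x\<close> and \<open>ip g x\<close> as pairings of
      \<open>ip (f n) (v i)\<close> and of \<open>a i\<close> with the square-summable family
      \<open>ip (v i) y\<close>.\<close>
    obtain y where y: "?S y = x" using frame_op_surj[OF fb] by blast
    have "(\<lambda>n. ip (f n) x - ip g x) \<longlonglongrightarrow> 0"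
    proof (rule has_sum_mult_tendsto_0)
      show "((\<lambda>i. (ip (f n) (v i) - a i) * ip (v i) y) has_sum (ip (f n) x - ip g x)) I" for n
        using has_sum_diff[OF frame_op_ip[OF bes, of "f n" y] synthesis_ip[OF h, of y]]
        by (simp add: frame_op_selfadjoint[OF bes] y left_diff_distrib flip: g)
      show "(\<lambda>i. (norm (ip (v i) y))\<^sup>2) summable_on I"
        using bessel_summable[OF bes, of y] by (simp add: norm_ip_commute[of _ y])
      show "(\<lambda>n. ip (f n) (v i) - a i) \<longlonglongrightarrow> 0" if "i \<in> I" for i
        using a[OF that] by (simp add: LIM_zero)
      show "(\<Sum>i\<in>F. (norm (ip (f n) (v i) - a i))\<^sup>2) \<le> 4 * B" if F: "finite F" "F \<subseteq> I" for n F
      proof -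
        have "(norm (p - q))\<^sup>2 \<le> 2 * (norm p)\<^sup>2 + 2 * (norm q)\<^sup>2" for p q :: 'k
        proof -
          have "(norm (p - q))\<^sup>2 \<le> (norm p + norm q)\<^sup>2"
            by (intro power_mono norm_triangle_ineq4) auto
          also have "\<dots> \<le> 2 * (norm p)\<^sup>2 + 2 * (norm q)\<^sup>2"
            using sum_squares_bound[of "norm p" "norm q"] by (simp add: power2_sum)
          finally show ?thesis .
        qed
        then have "(\<Sum>i\<in>F. (norm (ip (f n) (v i) - a i))\<^sup>2)
            \<le> (\<Sum>i\<in>F. 2 * (norm (ip (f n) (v i)))\<^sup>2 + 2 * (norm (a i))\<^sup>2)"
          by (intro sum_mono) auto
        also have "\<dots> \<le> 4 * B"
          using bf[OF F, of n] ba[OF F] by (simp add: sum.distrib flip: sum_distrib_left)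
        finally show ?thesis .
      qed
    qed
    then show "(\<lambda>n. ip (f n) x) \<longlonglongrightarrow> ip g x" by (rule LIM_zero_cancel)
  qed
qed

end

section \<open>The gliding hump\<close>

text \<open>Finite sets \<open>F j\<close> grow while indices \<open>N j\<close> are chosen so that
  the functions of index \<open>N (Suc j)\<close> are small on \<open>F j\<close> by the pointwise
  limits, and small off \<open>F (Suc j)\<close> by summability. On the block in between,
  \<open>J\<close> copies \<open>K (N (Suc j))\<close>, where the sum is small by
  hypothesis.\<close>

lemma gliding_hump:
  fixes p q :: "nat \<Rightarrow> 'i \<Rightarrow> real"
  assumes nn: "\<And>n i. 0 \<le> p n i" "\<And>n i. 0 \<le> q n i"
    and sm: "\<And>n. p n summable_on I" "\<And>n. q n summable_on I"
    and lim: "\<And>i. i \<in> I \<Longrightarrow> (\<lambda>n. p n i) \<longlonglongrightarrow> 0" "\<And>i. i \<in> I \<Longrightarrow> (\<lambda>n. q n i) \<longlonglongrightarrow> 0"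
    and K: "\<And>n G. finite G \<Longrightarrow> G \<subseteq> I \<Longrightarrow> (\<Sum>i\<in>G. if i \<in> K n then p n i else q n i) \<le> 1 / Suc n"
  obtains J where "J \<subseteq> I"
    "\<And>e. 0 < e \<Longrightarrow> \<exists>n. \<forall>G. finite G \<longrightarrow> G \<subseteq> I \<longrightarrow> (\<Sum>i\<in>G. if i \<in> J then p n i else q n i) \<le> e"
proof -
  define t where "t n i = p n i + q n i" for n i
  have tail: "\<exists>F. finite F \<and> E \<subseteq> F \<and> F \<subseteq> I \<and> (\<forall>G. finite G \<longrightarrow> G \<subseteq> I - F \<longrightarrow> sum (t n) G \<le> 1 / Suc j)"
    if "finite E" "E \<subseteq> I" for E n j
  proof -
    obtain F where F: "finite F" "F \<subseteq> I" "\<And>G. finite G \<Longrightarrow> G \<subseteq> I - F \<Longrightarrow> sum (t n) G < 1 / Suc j"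
    proof (rule nonneg_summable_tail)
      show "t n summable_on I" unfolding t_def by (intro summable_on_add sm)
    qed (auto simp: t_def nn)
    have "sum (t n) G \<le> 1 / Suc j" if "finite G" "G \<subseteq> I - (E \<union> F)" for G
      by (rule less_imp_le, rule F(3)) (use that in auto)
    with F that show ?thesis by (intro exI[of _ "E \<union> F"]) simp
  qed
  \<comment> \<open>\<open>P\<close> records smallness off the current set, \<open>Q\<close>
    smallness of the next index on the current set. The clause \<open>j \<le> n\<close> turns the
    bound \<open>1 / Suc n\<close> for \<open>K n\<close> into one that decreases with
    \<open>j\<close>.\<close>
  define P where "P = (\<lambda>j (n::nat, F). finite F \<and> F \<subseteq> I \<and> j \<le> n \<and>
      (\<forall>G. finite G \<longrightarrow> G \<subseteq> I - F \<longrightarrow> sum (t n) G \<le> 1 / Suc j))"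
  define Q where "Q = (\<lambda>j (n::nat, F) (n', F'). F \<subseteq> F' \<and> sum (t n') F \<le> 1 / Suc j)"
  have "\<exists>x. P 0 x"
    using tail[of "{}" 0 0] by (auto simp: P_def)
  moreover have "\<exists>y. P (Suc j) y \<and> Q j x y" if "P j x" for x j
  proof -
    obtain n F where x: "x = (n, F)" by (cases x)
    with that have F: "finite F" "F \<subseteq> I" by (auto simp: P_def)
    have "(\<lambda>n. sum (t n) F) \<longlonglongrightarrow> (\<Sum>i\<in>F. 0 + 0)"
      unfolding t_def using F lim by (intro tendsto_sum tendsto_add) auto
    then have "\<forall>\<^sub>F n in sequentially. sum (t n) F < 1 / Suc j"
      by (rule order_tendstoD(2)) simp
    from eventually_happens'[OF sequentially_bot eventually_conj[OF this eventually_ge_at_top[of "Suc j"]]]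
    obtain n' where n': "sum (t n') F < 1 / Suc j" "Suc j \<le> n'"
      by blast
    from tail[OF F, of n' "Suc j"] obtain F' where "finite F' \<and> F \<subseteq> F' \<and> F' \<subseteq> I \<and>
      (\<forall>G. finite G \<longrightarrow> G \<subseteq> I - F' \<longrightarrow> sum (t n') G \<le> 1 / Suc (Suc j))"
      by (rule exE)
    then have "P (Suc j) (n', F') \<and> Q j x (n', F')"
      using n' by (simp add: P_def Q_def x)
    then show ?thesis by blast
  qed
  ultimately have "\<exists>f. \<forall>j. P j (f j) \<and> Q j (f j) (f (Suc j))"
    by (rule dependent_nat_choice)
  then obtain f where f: "\<And>j. P j (f j)" "\<And>j. Q j (f j) (f (Suc j))" by blast
  define N where "N j = fst (f j)" for j
  define F where "F j = snd (f j)" for j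
  have F: "finite (F j)" "F j \<subseteq> I" "j \<le> N j" "F j \<subseteq> F (Suc j)" "sum (t (N (Suc j))) (F j) \<le> 1 / Suc j"
    and F_tail: "\<And>G. finite G \<Longrightarrow> G \<subseteq> I - F j \<Longrightarrow> sum (t (N j)) G \<le> 1 / Suc j" for j
    using f[of j] by (auto simp: P_def Q_def N_def F_def split: prod.splits)
  have mono: "F i \<subseteq> F j" if "i \<le> j" for i j
    using that F(4) by (rule lift_Suc_mono_le[rotated])
  \<comment> \<open>The blocks are pairwise disjoint, so the prescriptions from different
    \<open>j\<close> cannot conflict; indices in no block stay outside \<open>J\<close>.\<close>
  define J where "J = {i \<in> I. \<exists>j. i \<in> F (Suc j) - F j \<and> i \<in> K (N (Suc j))}"
  have J: "i \<in> J \<longleftrightarrow> i \<in> K (N (Suc j))" if "i \<in> F (Suc j) - F j" for i j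
  proof -
    have uniq: "j' = j" if "i \<in> F (Suc j') - F j'" for j'
    proof (rule ccontr)
      assume "j' \<noteq> j"
      then consider "Suc j' \<le> j" | "Suc j \<le> j'" by linarith
      then show False
        using mono that \<open>i \<in> F (Suc j) - F j\<close> by cases blast+
    qed
    have "i \<in> I" using that F(2)[of "Suc j"] by blast
    with that uniq show ?thesis unfolding J_def by blast
  qed
  show ?thesis
  proof
    show "J \<subseteq> I" by (auto simp: J_def)
    fix e :: real assume "0 < e"
    \<comment> \<open>The 3 counts the pieces of \<open>G\<close>: inside \<open>F j\<close>, in the
      block up to \<open>F (Suc j)\<close>, and beyond it, each contributing at most
      \<open>1 / Suc j\<close>.\<close>
    then obtain j where j: "3 / Suc j < e"
      using reals_Archimedean[of "e / 3"] by (auto simp: field_simps)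
    define n where "n = N (Suc j)"
    define s where "s i = (if i \<in> J then p n i else q n i)" for i
    have st: "0 \<le> s i" "s i \<le> t n i" "0 \<le> t n i" for i by (auto simp: s_def t_def nn)
    have "sum s G \<le> e" if G: "finite G" "G \<subseteq> I" for G
    proof -
      have "sum s (G \<inter> F j) \<le> sum (t n) (F j)"
        using F(1) by (intro order_trans[OF sum_mono sum_mono2] st) auto
      also have "\<dots> \<le> 1 / Suc j" unfolding n_def by (rule F)
      finally have 1: "sum s (G \<inter> F j) \<le> 1 / Suc j" .
      have "sum s (G - F (Suc j)) \<le> sum (t n) (G - F (Suc j))" by (intro sum_mono st)
      also have "\<dots> \<le> 1 / Suc (Suc j)" unfolding n_def using G by (intro F_tail) auto
      also have "\<dots> \<le> 1 / Suc j" by (simp add: field_simps)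
      finally have 2: "sum s (G - F (Suc j)) \<le> 1 / Suc j" .
      have "sum s (G \<inter> F (Suc j) - F j) = (\<Sum>i\<in>G \<inter> F (Suc j) - F j. if i \<in> K n then p n i else q n i)"
        using J[of _ j] by (intro sum.cong) (auto simp: s_def n_def)
      also have "\<dots> \<le> 1 / Suc n" using G by (intro K) auto
      also have "\<dots> \<le> 1 / Suc j" using F(3)[of "Suc j"] by (simp add: n_def frac_le)
      finally have 3: "sum s (G \<inter> F (Suc j) - F j) \<le> 1 / Suc j" .
      have "sum s G = sum s (G \<inter> F (Suc j)) + sum s (G - F (Suc j))"
        using G(1) by (rule sum.Int_Diff)
      also have "sum s (G \<inter> F (Suc j)) = sum s (G \<inter> F j) + sum s (G \<inter> F (Suc j) - F j)"
        using sum.Int_Diff[of "G \<inter> F (Suc j)" s "F j"] G(1) F(4)[of j]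
        by (simp add: Int_absorb1 inf_assoc)
      finally have "sum s G \<le> 3 / Suc j" using 1 2 3 by simp
      with j show ?thesis by simp
    qed
    then show "\<exists>n. \<forall>G. finite G \<longrightarrow> G \<subseteq> I \<longrightarrow> (\<Sum>i\<in>G. if i \<in> J then p n i else q n i) \<le> e"
      unfolding s_def by blast
  qed
qed

section \<open>Uniform bounds for all weavings\<close>

lemma bessel_weave:
  assumes "bessel ip I u B" "bessel ip I w C"
  shows "bessel ip I (\<lambda>i. if i \<in> J then u i else w i) (B + C)"
  unfolding bessel_def
proof (intro conjI allI impI)
  fix f F assume F: "finite F" "F \<subseteq> I"
  have "(\<Sum>i\<in>F. (norm (ip f (if i \<in> J then u i else w i)))\<^sup>2)
      \<le> (\<Sum>i\<in>F. (norm (ip f (u i)))\<^sup>2 + (norm (ip f (w i)))\<^sup>2)"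
    by (intro sum_mono) auto
  also have "\<dots> \<le> (B + C) * (norm f)\<^sup>2"
    using besselD[OF assms(1) F, of f] besselD[OF assms(2) F, of f]
    by (simp add: sum.distrib distrib_right)
  finally show "(\<Sum>i\<in>F. (norm (ip f (if i \<in> J then u i else w i)))\<^sup>2) \<le> (B + C) * (norm f)\<^sup>2" .
qed (use assms in \<open>simp add: bessel_def\<close>)

lemma wovenI:
  assumes "0 < A" "bessel ip I u B" "bessel ip I w C"
    and "\<And>J f. J \<subseteq> I \<Longrightarrow> A * (norm f)\<^sup>2 \<le> (\<Sum>\<^sub>\<infinity>i\<in>I. (norm (ip f (if i \<in> J then u i else w i)))\<^sup>2)"
  shows "woven ip I u w"
  unfolding woven_def
  using frame_boundsI[OF assms(1) bessel_weave[OF assms(2,3)] assms(4)] by blast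

text \<open>The Bessel bounds of \<open>u\<close> and \<open>w\<close> add up to an upper bound
  common to all weavings, so only a common lower bound can fail. Its failure for every
  \<open>1 / Suc n\<close> yields the sequences to be refuted.\<close>

lemma (in hilbert_space) woven_if_all_frames:
  assumes I: "countable I"
    and fr: "\<And>J. J \<subseteq> I \<Longrightarrow> is_frame ip I (\<lambda>i. if i \<in> J then u i else w i)"
  shows "woven ip I u w"
proof (rule ccontr)
  assume nw: "\<not> woven ip I u w"
  define W where "W J i = (if i \<in> J then u i else w i)" for J i
  have frW: "is_frame ip I (W J)" if "J \<subseteq> I" for J
    using fr[OF that] by (simp add: W_def[abs_def])
  \<comment> \<open>On \<open>I\<close>, the weavings along \<open>I\<close> and along
    \<open>{}\<close> are \<open>u\<close> and \<open>w\<close>.\<close>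
  obtain Au Bu where "frame_bounds ip I (W I) Au Bu"
    using frW[of I] by (auto simp: is_frame_def)
  moreover have "frame_bounds ip I (W I) Au Bu \<longleftrightarrow> frame_bounds ip I u Au Bu"
    unfolding frame_bounds_def W_def by (simp cong: infsum_cong summable_on_cong)
  ultimately have fbu: "frame_bounds ip I u Au Bu" by simp
  note bu = frame_bounds_bessel[OF fbu]
  obtain Bw where bw: "bessel ip I w Bw"
    using frW[of "{}"] frame_bounds_bessel[of ip I w] by (auto simp: is_frame_def W_def[abs_def])
  have sumW: "(\<lambda>i. (norm (ip f (W J i)))\<^sup>2) summable_on I" for f J
    unfolding W_def by (rule bessel_summable[OF bessel_weave[OF bu bw]])
  have "\<exists>J g. J \<subseteq> I \<and> norm g = 1 \<and> (\<Sum>\<^sub>\<infinity>i\<in>I. (norm (ip g (W J i)))\<^sup>2) < 1 / Suc n" for n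
  proof -
    obtain J f where J: "J \<subseteq> I" "(\<Sum>\<^sub>\<infinity>i\<in>I. (norm (ip f (W J i)))\<^sup>2) < 1 / Suc n * (norm f)\<^sup>2"
      using wovenI[of "1 / Suc n" ip I u Bu w Bw] bu bw nw unfolding W_def
      by (meson not_le of_nat_0_less_iff zero_less_Suc zero_less_divide_1_iff)
    then have f: "f \<noteq> 0" by auto
    have "(\<Sum>\<^sub>\<infinity>i\<in>I. (norm (ip (inverse (norm f) *\<^sub>R f) (W J i)))\<^sup>2)
        = (\<Sum>\<^sub>\<infinity>i\<in>I. (inverse (norm f))\<^sup>2 * (norm (ip f (W J i)))\<^sup>2)"
      by (simp add: ip_scaleR_left power_mult_distrib)
    also have "\<dots> = (inverse (norm f))\<^sup>2 * (\<Sum>\<^sub>\<infinity>i\<in>I. (norm (ip f (W J i)))\<^sup>2)"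
      by (rule infsum_cmult_right')
    also have "\<dots> < (inverse (norm f))\<^sup>2 * (1 / Suc n * (norm f)\<^sup>2)"
      using J(2) f by (intro mult_strict_left_mono) auto
    also have "\<dots> = 1 / Suc n" using f by (simp add: power_inverse)
    finally show ?thesis
      using J(1) f by (intro exI[of _ J] exI[of _ "inverse (norm f) *\<^sub>R f"]) auto
  qed
  then obtain K0 f0 where K0: "\<And>n. K0 n \<subseteq> I" and f0: "\<And>n. norm (f0 n) = 1"
    and small0: "\<And>n. (\<Sum>\<^sub>\<infinity>i\<in>I. (norm (ip (f0 n) (W (K0 n) i)))\<^sup>2) < 1 / Suc n"
    by metis
  have "norm (ip (f0 n) (u i)) \<le> sqrt Bu" if "i \<in> I" for n i
    using bessel_norm_le[OF bu that, of "f0 n"] f0[of n] by (intro real_le_rsqrt) simp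
  then obtain k where k: "strict_mono (k :: nat \<Rightarrow> nat)"
    and kl: "\<And>i. i \<in> I \<Longrightarrow> \<exists>l. (\<lambda>n. ip (f0 (k n)) (u i)) \<longlonglongrightarrow> l"
    and kK: "\<And>i. i \<in> I \<Longrightarrow> \<exists>b. \<forall>\<^sub>F n in sequentially. (i \<in> K0 (k n)) = b"
    using scalar_set_convergent_subsequence[OF I, of "\<lambda>n i. ip (f0 n) (u i)" "sqrt Bu" K0] by metis
  define f K where "f n = f0 (k n)" and "K n = K0 (k n)" for n
  have f1: "norm (f n) = 1" for n using f0 by (auto simp: f_def)
  have small: "(\<Sum>i\<in>G. (norm (ip (f n) (W (K n) i)))\<^sup>2) \<le> 1 / Suc n" if "finite G" "G \<subseteq> I" for G n
  proof -
    have "(\<Sum>i\<in>G. (norm (ip (f n) (W (K n) i)))\<^sup>2) \<le> (\<Sum>\<^sub>\<infinity>i\<in>I. (norm (ip (f n) (W (K n) i)))\<^sup>2)"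
      using that by (intro finite_sum_le_infsum sumW) auto
    also have "\<dots> \<le> 1 / Suc (k n)" using small0 by (simp add: f_def K_def less_imp_le)
    also have "\<dots> \<le> 1 / Suc n" using seq_suble[OF k, of n] by (simp add: frac_le)
    finally show ?thesis .
  qed
  have "\<forall>i\<in>I. \<exists>l. (\<lambda>n. ip (f n) (u i)) \<longlonglongrightarrow> l"
    using kl by (simp add: f_def)
  from bchoice[OF this] obtain l where l: "\<And>i. i \<in> I \<Longrightarrow> (\<lambda>n. ip (f n) (u i)) \<longlonglongrightarrow> l i"
    by blast
  obtain g where g: "\<And>x. (\<lambda>n. ip (f n) x) \<longlonglongrightarrow> ip g x"
    by (rule frame_weak_limit[OF fbu eq_refl[OF f1] l]) auto
  \<comment> \<open>Every \<open>i\<close> in \<open>I\<close> is eventually always or eventually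
    never in \<open>K n\<close>, so \<open>J\<close> is the pointwise limit of the sets
    \<open>K n\<close>.\<close>
  define J where "J = {i \<in> I. \<forall>\<^sub>F n in sequentially. i \<in> K n}"
  have JK: "\<forall>\<^sub>F n in sequentially. W J i = W (K n) i" if i: "i \<in> I" for i
  proof -
    obtain b where b: "\<forall>\<^sub>F n in sequentially. (i \<in> K n) = b"
      using kK[OF i] unfolding K_def by blast
    have "i \<in> J \<longleftrightarrow> b"
      using eventually_subst[OF b] i by (simp add: J_def)
    then show ?thesis by (intro eventually_mono[OF b]) (simp add: W_def)
  qed
  have gJ: "ip g (W J i) = 0" if i: "i \<in> I" for i
  proof -
    have "(\<lambda>n. (norm (ip (f n) (W J i)))\<^sup>2) \<longlonglongrightarrow> (norm (ip g (W J i)))\<^sup>2"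
      by (intro tendsto_power tendsto_norm g)
    moreover have "\<forall>\<^sub>F n in sequentially. (norm (ip (f n) (W J i)))\<^sup>2 \<le> 1 / Suc n"
      using JK[OF i] small[of "{i}"] i by (auto elim!: eventually_mono)
    then have "\<forall>\<^sub>F n in sequentially. (norm (ip (f n) (W J i)))\<^sup>2 \<le> inverse (real (Suc n))"
      by (simp add: inverse_eq_divide)
    ultimately have "(norm (ip g (W J i)))\<^sup>2 \<le> 0"
      using LIMSEQ_inverse_real_of_nat by (intro tendsto_le[OF sequentially_bot])
    then show ?thesis by simp
  qed
  have "J \<subseteq> I" by (auto simp: J_def)
  then obtain A B where AB: "frame_bounds ip I (W J) A B"
    using frW[of J] by (auto simp: is_frame_def)
  have "(\<Sum>\<^sub>\<infinity>i\<in>I. (norm (ip g (W J i)))\<^sup>2) = 0"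
    using gJ by (intro infsum_0) simp
  moreover have "0 < A" "A * (norm g)\<^sup>2 \<le> (\<Sum>\<^sub>\<infinity>i\<in>I. (norm (ip g (W J i)))\<^sup>2)"
    using AB by (auto simp: frame_bounds_def)
  ultimately have "g = 0" by (simp add: mult_le_0_iff)
  \<comment> \<open>Now \<open>f n\<close> tends weakly to 0, which supplies the pointwise limits
    that the gliding hump asks for.\<close>
  then have f0: "(\<lambda>n. (norm (ip (f n) x))\<^sup>2) \<longlonglongrightarrow> 0" for x
    using tendsto_power[OF tendsto_norm[OF g[of x]], of 2] by simp
  obtain J' where J': "J' \<subseteq> I" and
    hump: "\<And>e. 0 < e \<Longrightarrow> \<exists>n. \<forall>G. finite G \<longrightarrow> G \<subseteq> I \<longrightarrow>
      (\<Sum>i\<in>G. if i \<in> J' then (norm (ip (f n) (u i)))\<^sup>2 else (norm (ip (f n) (w i)))\<^sup>2) \<le> e"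
  proof (rule gliding_hump[where p="\<lambda>n i. (norm (ip (f n) (u i)))\<^sup>2" and q="\<lambda>n i. (norm (ip (f n) (w i)))\<^sup>2"
        and I=I and K=K])
    fix n G assume G: "finite G" "G \<subseteq> I"
    have "(\<Sum>i\<in>G. if i \<in> K n then (norm (ip (f n) (u i)))\<^sup>2 else (norm (ip (f n) (w i)))\<^sup>2)
        = (\<Sum>i\<in>G. (norm (ip (f n) (W (K n) i)))\<^sup>2)"
      by (intro sum.cong) (auto simp: W_def)
    also have "\<dots> \<le> 1 / Suc n" using small[OF G] .
    finally show "(\<Sum>i\<in>G. if i \<in> K n then (norm (ip (f n) (u i)))\<^sup>2 else (norm (ip (f n) (w i)))\<^sup>2) \<le> 1 / Suc n" .
  qed (use f0 bu bw in \<open>auto intro: bessel_summable\<close>)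
  obtain A B where AB: "frame_bounds ip I (W J') A B"
    using frW[OF J'] by (auto simp: is_frame_def)
  then have A: "0 < A" by (simp add: frame_bounds_def)
  \<comment> \<open>A unit vector with frame sum at most \<open>A / 2\<close> along
    \<open>J'\<close> contradicts the lower bound \<open>A\<close>.\<close>
  then obtain n where n: "\<And>G. finite G \<Longrightarrow> G \<subseteq> I \<Longrightarrow>
      (\<Sum>i\<in>G. if i \<in> J' then (norm (ip (f n) (u i)))\<^sup>2 else (norm (ip (f n) (w i)))\<^sup>2) \<le> A / 2"
    using hump[of "A / 2"] by auto
  have "A * (norm (f n))\<^sup>2 \<le> (\<Sum>\<^sub>\<infinity>i\<in>I. (norm (ip (f n) (W J' i)))\<^sup>2)"
    using AB by (simp add: frame_bounds_def)
  also have "\<dots> \<le> A / 2"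
  proof (rule infsum_le_finite_sums[OF sumW])
    fix G assume G: "finite G" "G \<subseteq> I"
    have "(\<Sum>i\<in>G. (norm (ip (f n) (W J' i)))\<^sup>2)
        = (\<Sum>i\<in>G. if i \<in> J' then (norm (ip (f n) (u i)))\<^sup>2 else (norm (ip (f n) (w i)))\<^sup>2)"
      by (intro sum.cong) (auto simp: W_def)
    also have "\<dots> \<le> A / 2" using n[OF G] .
    finally show "(\<Sum>i\<in>G. (norm (ip (f n) (W J' i)))\<^sup>2) \<le> A / 2" .
  qed
  finally show False using A f1[of n] by simp
qed

section \<open>Subspace distance and images of Bessel families\<close>

context hilbert_space
begin

lemma closed_span_scaleR:
  assumes "x \<in> closed_span scl X"
  shows "r *\<^sub>R x \<in> closed_span scl X"
proof -
  have "(*\<^sub>R) r ` span X \<subseteq> span X"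
    by (auto simp: span_scale simp flip: scl_of_real)
  from closure_mono[OF this] show ?thesis
    using assms unfolding closed_span_def closure_scaleR[symmetric] by blast
qed

text \<open>Dividing by \<open>norm y\<close> reduces the estimate to a unit vector of the second
  subspace, where the infimum applies.\<close>

lemma subspace_dist_gap:
  assumes "ereal M < subspace_dist (closed_span scl X) (closed_span scl Y)"
  obtains d where "M < d"
    "\<And>x y. x \<in> closed_span scl X \<Longrightarrow> y \<in> closed_span scl Y \<Longrightarrow> d * norm y \<le> norm (x + y)"
proof -
  \<comment> \<open>The distance may be infinite, so a real number strictly below it is
    chosen.\<close>
  obtain d where d: "ereal M < ereal d"
      "ereal d < subspace_dist (closed_span scl X) (closed_span scl Y)"
    using ereal_dense2[OF assms] by blast
  then have inf: "ereal d < (INF (f, g) \<in> closed_span scl X \<times> unit_vectors (closed_span scl Y). ereal (norm (f - g)))"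
    by (simp add: subspace_dist_def)
  show ?thesis
  proof
    show "M < d" using d by simp
    fix x y assume x: "x \<in> closed_span scl X" and y: "y \<in> closed_span scl Y"
    show "d * norm y \<le> norm (x + y)"
    proof (cases "y = 0")
      case False
      define r where "r = inverse (norm y)"
      \<comment> \<open>The sign turns the sum \<open>x + y\<close> into the difference that the
        distance measures.\<close>
      have "(- r) *\<^sub>R y \<in> unit_vectors (closed_span scl Y)"
        using False closed_span_scaleR[OF y, of "- r"] by (simp add: unit_vectors_def r_def)
      with closed_span_scaleR[OF x, of r]
      have "(r *\<^sub>R x, (- r) *\<^sub>R y) \<in> closed_span scl X \<times> unit_vectors (closed_span scl Y)"
        by blast
      from less_INF_D[OF inf this] have "d < norm (r *\<^sub>R x - (- r) *\<^sub>R y)" by simp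
      also have "r *\<^sub>R x - (- r) *\<^sub>R y = r *\<^sub>R (x + y)" by (simp add: scaleR_add_right)
      also have "norm (r *\<^sub>R (x + y)) = norm (x + y) / norm y"
        by (simp add: r_def divide_inverse mult.commute del: scaleR_add_right)
      finally show ?thesis using False by (simp add: pos_less_divide_eq)
    qed simp
  qed
qed

text \<open>Argued on the synthesis side, where \<open>T\<close> passes through finite sums, so that
  no adjoint of \<open>T\<close> enters.\<close>

lemma bessel_image:
  assumes "bounded_op scl T" "bessel ip I v B"
  shows "bessel ip I (\<lambda>i. T (v i)) ((onorm T)\<^sup>2 * B)"
proof (rule besselI_synthesis)
  interpret T: bounded_linear T using assms(1) by (simp add: bounded_op_def)
  have B: "0 \<le> B" using assms(2) by (simp add: bessel_def)
  then show "0 \<le> (onorm T)\<^sup>2 * B" by simp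
  fix F c assume F: "finite F" "F \<subseteq> I"
  have "(\<Sum>i\<in>F. scl (c i) (T (v i))) = T (\<Sum>i\<in>F. scl (c i) (v i))"
    using assms(1) by (simp add: T.sum bounded_op_def)
  then have "(norm (\<Sum>i\<in>F. scl (c i) (T (v i))))\<^sup>2 \<le> (onorm T * norm (\<Sum>i\<in>F. scl (c i) (v i)))\<^sup>2"
    using onorm[OF T.bounded_linear_axioms] by (intro power_mono) auto
  also have "\<dots> \<le> (onorm T)\<^sup>2 * (B * (\<Sum>i\<in>F. (norm (c i))\<^sup>2))"
    unfolding power_mult_distrib
    by (intro mult_left_mono synthesis_finite_bound[OF assms(2) F]) auto
  finally show "(norm (\<Sum>i\<in>F. scl (c i) (T (v i))))\<^sup>2 \<le> (onorm T)\<^sup>2 * B * (\<Sum>i\<in>F. (norm (c i))\<^sup>2)"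
    by (simp add: mult.assoc)
qed

section \<open>Part (i): weaving with the canonical dual\<close>

text \<open>Evaluated at \<open>v i\<close>, the commutation relation makes
  \<open>(norm (v i))^2\<close> times the image of \<open>v i\<close> a real multiple of
  \<open>v i\<close>. The factor is the frame sum at \<open>v i\<close>, which the lower bound
  controls.\<close>

lemma frame_op_commute_eigenvector:
  assumes fb: "frame_bounds ip I v A B" and i: "i \<in> I"
    and comm: "frame_op scl ip I v \<circ> frame_op scl ip {i} v = frame_op scl ip {i} v \<circ> frame_op scl ip I v"
  obtains r where "A \<le> r" "frame_op scl ip I v (v i) = r *\<^sub>R v i"
proof (cases "v i = 0")
  case True
  have "frame_op scl ip I v 0 = 0"
    using frame_op_diff[OF frame_bounds_bessel[OF fb], of 0 0] by simp
  then show ?thesis using that[of A] True by simp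
next
  case False
  note bes = frame_bounds_bessel[OF fb]
  define s where "s = (\<Sum>\<^sub>\<infinity>j\<in>I. (norm (ip (v i) (v j)))\<^sup>2)"
  have one: "frame_op scl ip {i} v x = scl (ip x (v i)) (v i)" for x
    by (simp add: frame_op_def)
  have "scl (ip (v i) (v i)) (frame_op scl ip I v (v i)) = scl (ip (frame_op scl ip I v (v i)) (v i)) (v i)"
    using fun_cong[OF comm, of "v i"] by (simp add: one frame_op_scl[OF bes])
  then have "(norm (v i))\<^sup>2 *\<^sub>R frame_op scl ip I v (v i) = s *\<^sub>R v i"
    unfolding frame_op_ip_self[OF bes] ip_self scl_of_real s_def .
  then have "inverse ((norm (v i))\<^sup>2) *\<^sub>R ((norm (v i))\<^sup>2 *\<^sub>R frame_op scl ip I v (v i))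
      = inverse ((norm (v i))\<^sup>2) *\<^sub>R (s *\<^sub>R v i)"
    by simp
  then have "frame_op scl ip I v (v i) = (s / (norm (v i))\<^sup>2) *\<^sub>R v i"
    using False by (simp add: field_simps)
  moreover have "A * (norm (v i))\<^sup>2 \<le> s"
    using fb by (simp add: frame_bounds_def s_def)
  then have "A \<le> s / (norm (v i))\<^sup>2"
    using False by (simp add: pos_le_divide_eq)
  ultimately show ?thesis using that by blast
qed

theorem woven_canonical_dual:
  assumes fr: "is_frame ip I \<phi>"
    and ge: "op_ge ip (inv (frame_op scl ip I \<phi>)) id"
    and comm: "\<And>i. i \<in> I \<Longrightarrow>
      frame_op scl ip I \<phi> \<circ> frame_op scl ip {i} \<phi> = frame_op scl ip {i} \<phi> \<circ> frame_op scl ip I \<phi>"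
  shows "woven ip I \<phi> (\<lambda>i. inv (frame_op scl ip I \<phi>) (\<phi> i))"
proof -
  let ?S = "frame_op scl ip I \<phi>"
  obtain A B where fb: "frame_bounds ip I \<phi> A B" using fr by (auto simp: is_frame_def)
  note bes = frame_bounds_bessel[OF fb]
  have A: "0 < A" and B: "0 \<le> B" using fb by (auto simp: frame_bounds_def)
  \<comment> \<open>\<open>1 / A\<close> bounds the reciprocal eigenvalues; the 1 covers indices
    with \<open>\<phi> i = 0\<close>, where \<open>s = 1\<close> is taken.\<close>
  define M where "M = max 1 (1 / A)"
  have "inj ?S"
  proof (rule injI)
    fix x y assume "?S x = ?S y"
    then have "A * norm (x - y) \<le> 0"
      using frame_op_lower[OF fb, of "x - y"] by (simp add: frame_op_diff[OF bes])
    then show "x = y" using A by (simp add: mult_le_0_iff)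
  qed
  have dual: "\<exists>s. inv ?S (\<phi> i) = s *\<^sub>R \<phi> i \<and> 1 \<le> s \<and> s \<le> M" if i: "i \<in> I" for i
  proof -
    obtain r where r: "A \<le> r" "?S (\<phi> i) = r *\<^sub>R \<phi> i"
      using frame_op_commute_eigenvector[OF fb i comm[OF i]] .
    have "?S ((1 / r) *\<^sub>R \<phi> i) = (1 / r) *\<^sub>R ?S (\<phi> i)"
      using frame_op_scl[OF bes, of "of_real (1 / r)"] unfolding scl_of_real .
    also have "\<dots> = \<phi> i" using r A by simp
    finally have inv: "inv ?S (\<phi> i) = (1 / r) *\<^sub>R \<phi> i"
      using inv_f_eq[OF \<open>inj ?S\<close>] by blast
    show ?thesis
    proof (cases "\<phi> i = 0")
      case True
      then show ?thesis using inv by (intro exI[of _ 1]) (simp add: M_def)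
    next
      case False
      \<comment> \<open>Tested on the eigenvector \<open>\<phi> i\<close>, the operator inequality
        becomes the scalar inequality \<open>1 \<le> 1 / r\<close>.\<close>
      obtain q where q: "0 \<le> q" "ip (inv ?S (\<phi> i) - \<phi> i) (\<phi> i) = of_real q"
        using ge by (auto simp: op_ge_def)
      have "ip (inv ?S (\<phi> i) - \<phi> i) (\<phi> i) = of_real ((1 / r - 1) * (norm (\<phi> i))\<^sup>2)"
        unfolding inv by (simp add: ip_diff_left ip_scaleR_left ip_self left_diff_distrib scaleR_conv_of_real)
      then have "q = (1 / r - 1) * (norm (\<phi> i))\<^sup>2"
        using q(2) by (simp only: of_real_eq_iff)
      with q(1) False have "1 \<le> 1 / r"
        by (simp add: zero_le_mult_iff)
      moreover have "1 / r \<le> 1 / A" using A r(1) by (simp add: frac_le)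
      ultimately show ?thesis using inv by (intro exI[of _ "1 / r"]) (simp add: M_def)
    qed
  qed
  have norm_dual: "(norm (ip f (\<phi> i)))\<^sup>2 \<le> (norm (ip f (inv ?S (\<phi> i))))\<^sup>2"
    "(norm (ip f (inv ?S (\<phi> i))))\<^sup>2 \<le> M\<^sup>2 * (norm (ip f (\<phi> i)))\<^sup>2" if i: "i \<in> I" for f i
  proof -
    obtain s where s: "inv ?S (\<phi> i) = s *\<^sub>R \<phi> i" "1 \<le> s" "s \<le> M" using dual[OF i] by blast
    have eq: "norm (ip f (inv ?S (\<phi> i))) = s * norm (ip f (\<phi> i))"
      using s by (simp add: norm_ip_commute[of f] ip_scaleR_left)
    show "(norm (ip f (\<phi> i)))\<^sup>2 \<le> (norm (ip f (inv ?S (\<phi> i))))\<^sup>2"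
      unfolding eq using mult_right_mono[OF s(2), of "norm (ip f (\<phi> i))"] by (intro power_mono) auto
    show "(norm (ip f (inv ?S (\<phi> i))))\<^sup>2 \<le> M\<^sup>2 * (norm (ip f (\<phi> i)))\<^sup>2"
      unfolding eq power_mult_distrib using s by (intro mult_right_mono power_mono) auto
  qed
  have besd: "bessel ip I (\<lambda>i. inv ?S (\<phi> i)) (M\<^sup>2 * B)"
    unfolding bessel_def
  proof (intro conjI allI impI)
    fix f F assume F: "finite F" "F \<subseteq> I"
    have "(\<Sum>i\<in>F. (norm (ip f (inv ?S (\<phi> i))))\<^sup>2) \<le> (\<Sum>i\<in>F. M\<^sup>2 * (norm (ip f (\<phi> i)))\<^sup>2)"
      using F by (intro sum_mono norm_dual) auto
    also have "\<dots> \<le> M\<^sup>2 * (B * (norm f)\<^sup>2)"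
      unfolding sum_distrib_left[symmetric] by (intro mult_left_mono besselD[OF bes F]) simp
    finally show "(\<Sum>i\<in>F. (norm (ip f (inv ?S (\<phi> i))))\<^sup>2) \<le> M\<^sup>2 * B * (norm f)\<^sup>2"
      by (simp add: mult.assoc)
  qed (use B in simp)
  show ?thesis
  proof (rule wovenI[OF A bes besd])
    fix J f
    have "A * (norm f)\<^sup>2 \<le> (\<Sum>\<^sub>\<infinity>i\<in>I. (norm (ip f (\<phi> i)))\<^sup>2)"
      using fb by (simp add: frame_bounds_def)
    also have "\<dots> \<le> (\<Sum>\<^sub>\<infinity>i\<in>I. (norm (ip f (if i \<in> J then \<phi> i else inv ?S (\<phi> i))))\<^sup>2)"
    proof (intro infsum_mono bessel_summable[OF bes] bessel_summable[OF bessel_weave[OF bes besd]])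
      fix i assume "i \<in> I"
      then show "(norm (ip f (\<phi> i)))\<^sup>2 \<le> (norm (ip f (if i \<in> J then \<phi> i else inv ?S (\<phi> i))))\<^sup>2"
        using norm_dual(1)[of i f] by (cases "i \<in> J") simp_all
    qed
    finally show "A * (norm f)\<^sup>2 \<le> (\<Sum>\<^sub>\<infinity>i\<in>I. (norm (ip f (if i \<in> J then \<phi> i else inv ?S (\<phi> i))))\<^sup>2)" .
  qed
qed

section \<open>Part (ii): weaving of operator images\<close>

lemma norm_ip_synthesis_le:
  assumes "((\<lambda>i. scl (c i) (v i)) has_sum x) I"
    and c: "\<And>F. finite F \<Longrightarrow> F \<subseteq> I \<Longrightarrow> (\<Sum>i\<in>F. (norm (c i))\<^sup>2) \<le> C"
    and f: "(\<lambda>i. (norm (ip f (v i)))\<^sup>2) summable_on I"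
  shows "norm (ip x f) \<le> sqrt C * sqrt (\<Sum>\<^sub>\<infinity>i\<in>I. (norm (ip f (v i)))\<^sup>2)"
proof (rule norm_has_sum_le[OF synthesis_ip[OF assms(1)]])
  fix F assume F: "finite F" "F \<subseteq> I"
  have "(norm (\<Sum>i\<in>F. c i * ip (v i) f))\<^sup>2 \<le> (\<Sum>i\<in>F. (norm (c i))\<^sup>2) * (\<Sum>i\<in>F. (norm (ip f (v i)))\<^sup>2)"
    using norm_sum_mult_sq_le[of c "\<lambda>i. ip (v i) f" F] by (simp add: norm_ip_commute[of f])
  also have "\<dots> \<le> C * (\<Sum>\<^sub>\<infinity>i\<in>I. (norm (ip f (v i)))\<^sup>2)"
    using c[of "{}"] F f by (intro mult_mono c finite_sum_le_infsum sum_nonneg) auto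
  finally show "norm (\<Sum>i\<in>F. c i * ip (v i) f) \<le> sqrt C * sqrt (\<Sum>\<^sub>\<infinity>i\<in>I. (norm (ip f (v i)))\<^sup>2)"
    unfolding real_sqrt_mult[symmetric] by (rule real_le_rsqrt)
qed

lemma frame_weave_images:
  assumes fb: "frame_bounds ip I (\<lambda>i. if i \<in> J then \<phi> i else \<psi> i) A B"
    and bes: "bessel ip I \<phi> B1" "bessel ip I \<psi> B2"
    and T: "bounded_invertible_op scl T1" "bounded_op scl T2" and J: "J \<subseteq> I"
    and dist: "ereal (onorm (\<lambda>x. T1 x - T2 x) * onorm (inv T1))
        < subspace_dist (closed_span scl (\<phi> ` J)) (closed_span scl (\<psi> ` (I - J)))"
  shows "is_frame ip I (\<lambda>i. if i \<in> J then T1 (\<phi> i) else T2 (\<psi> i))"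
proof -
  let ?v = "\<lambda>i. if i \<in> J then \<phi> i else \<psi> i"
  let ?w = "\<lambda>i. if i \<in> J then T1 (\<phi> i) else T2 (\<psi> i)"
  have T1: "bounded_linear T1" "\<And>c x. T1 (scl c x) = scl c (T1 x)"
    and T2: "bounded_linear T2" "\<And>c x. T2 (scl c x) = scl c (T2 x)"
    and Ti: "bounded_linear (inv T1)" "bij T1"
    using T by (auto simp: bounded_invertible_op_def bounded_op_def)
  have D: "bounded_linear (\<lambda>x. T1 x - T2 x)" using T1 T2 by (intro bounded_linear_sub)
  define n m where "n = onorm (\<lambda>x. T1 x - T2 x)" and "m = onorm (inv T1)"
  have nm: "0 \<le> n" "0 \<le> m" unfolding n_def m_def using D Ti by (auto intro: onorm_pos_le)
  obtain d where d: "n * m < d" and gap: "\<And>x y. x \<in> closed_span scl (\<phi> ` J) \<Longrightarrow>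
      y \<in> closed_span scl (\<psi> ` (I - J)) \<Longrightarrow> d * norm y \<le> norm (x + y)"
    using subspace_dist_gap[OF dist] unfolding n_def m_def by metis
  have d0: "0 < d" using d nm by (smt (verit) mult_nonneg_nonneg)
  have AB: "0 < A" "A \<le> B" using fb by (auto simp: frame_bounds_def)
  \<comment> \<open>The square root bounds the coefficients of \<open>x\<close> by
    \<open>norm x\<close>, and \<open>m\<close> bounds \<open>norm x\<close> by
    \<open>norm f\<close>; \<open>m + 1\<close> keeps \<open>C\<close> positive even if
    \<open>m = 0\<close>.\<close>
  define C where "C = sqrt (B / A\<^sup>2) * (m + 1)"
  \<comment> \<open>This arises from the chain \<open>norm (T1 z - T2 z) \<le> n * norm z \<le> n *
    norm x / d \<le> n * m / d * norm f\<close>.\<close>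
  define q where "q = n * m / d"
  have C: "0 < C" using AB nm by (simp add: C_def)
  have q: "q < 1" using d d0 by (simp add: q_def)
  have besw: "bessel ip I ?w ((onorm T1)\<^sup>2 * B1 + (onorm T2)\<^sup>2 * B2)"
    using T by (intro bessel_weave bessel_image bes) (simp_all add: bounded_invertible_op_def)
  have lower: "((1 - q) / C)\<^sup>2 * (norm f)\<^sup>2 \<le> (\<Sum>\<^sub>\<infinity>i\<in>I. (norm (ip f (?w i)))\<^sup>2)" for f
  proof -
    define a where "a = (\<Sum>\<^sub>\<infinity>i\<in>I. (norm (ip f (?w i)))\<^sup>2)"
    have a0: "0 \<le> a" unfolding a_def by (intro infsum_nonneg) auto
    define x where "x = inv T1 f"
    have x: "T1 x = f" "norm x \<le> m * norm f"
      using Ti onorm[OF Ti(1), of f] by (simp_all add: x_def m_def bij_is_surj surj_f_inv_f)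
    obtain c where c: "((\<lambda>i. scl (c i) (?v i)) has_sum x) I"
      "\<And>F. finite F \<Longrightarrow> F \<subseteq> I \<Longrightarrow> (\<Sum>i\<in>F. (norm (c i))\<^sup>2) \<le> B / A\<^sup>2 * (norm x)\<^sup>2"
      using frame_expansion[OF fb] by blast
    have part: "\<exists>y. ((\<lambda>i. scl (c i) (?v i)) has_sum y) K" if "K \<subseteq> I" for K
      using summable_on_subset_banach[OF has_sum_imp_summable[OF c(1)] that] by (auto simp: summable_on_def)
    \<comment> \<open>Splitting the expansion along \<open>J\<close> lets \<open>T1\<close> act on
      one part and \<open>T2\<close> on the other, so that \<open>?w\<close> synthesises
      \<open>T1 y + T2 z\<close> with unchanged coefficients.\<close>
    obtain y z where y: "((\<lambda>i. scl (c i) (?v i)) has_sum y) J"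
      and z: "((\<lambda>i. scl (c i) (?v i)) has_sum z) (I - J)"
      using part[OF J] part[of "I - J"] by auto
    have IJ: "J \<union> (I - J) = I" using J by auto
    have xyz: "x = y + z"
      using has_sum_unique[OF c(1)] has_sum_Un_disjoint[OF y z, unfolded IJ] by blast
    have y': "((\<lambda>i. scl (c i) (\<phi> i)) has_sum y) J"
      using y by (simp cong: has_sum_cong)
    have z': "((\<lambda>i. scl (c i) (\<psi> i)) has_sum z) (I - J)"
      using z by (rule iffD1[OF has_sum_cong, rotated]) simp
    have "y \<in> closed_span scl (\<phi> ` J)" "z \<in> closed_span scl (\<psi> ` (I - J))"
      using has_sum_in_closed_span[OF module_axioms y'] has_sum_in_closed_span[OF module_axioms z'] .
    then have dz: "d * norm z \<le> norm x" using gap xyz by simp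
    have Ty: "((\<lambda>i. scl (c i) (?w i)) has_sum T1 y) J"
      using has_sum_bounded_linear[OF T1(1) y'] by (simp add: T1(2) cong: has_sum_cong)
    have Tz: "((\<lambda>i. scl (c i) (?w i)) has_sum T2 z) (I - J)"
      using has_sum_bounded_linear[OF T2(1) z'] by (rule iffD1[OF has_sum_cong, rotated]) (simp add: T2(2))
    have "((\<lambda>i. scl (c i) (?w i)) has_sum (T1 y + T2 z)) I"
      using has_sum_Un_disjoint[OF Ty Tz, unfolded IJ] by blast
    from norm_ip_synthesis_le[OF this c(2) bessel_summable[OF besw]]
    have 1: "norm (ip (T1 y + T2 z) f) \<le> sqrt (B / A\<^sup>2) * norm x * sqrt a"
      unfolding a_def real_sqrt_mult by simp
    \<comment> \<open>Since \<open>f = T1 y + T1 z\<close>, replacing \<open>T1 z\<close> by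
      \<open>T2 z\<close> costs only the perturbation term, which is absorbed because
      \<open>q < 1\<close>.\<close>
    have "f = (T1 y + T2 z) + (T1 z - T2 z)"
      using x(1) xyz by (simp add: linear_add[OF bounded_linear.linear[OF T1(1)]])
    then have "ip f f = ip (T1 y + T2 z) f + ip (T1 z - T2 z) f"
      by (metis ip_add_left)
    then have "norm (ip f f) \<le> norm (ip (T1 y + T2 z) f) + norm (ip (T1 z - T2 z) f)"
      by (simp only: norm_triangle_ineq)
    moreover have "norm (ip f f) = (norm f)\<^sup>2" by (simp add: ip_self norm_power)
    ultimately have "(norm f)\<^sup>2 \<le> norm (ip (T1 y + T2 z) f) + norm (ip (T1 z - T2 z) f)" by simp
    also have "norm (ip (T1 z - T2 z) f) \<le> q * (norm f)\<^sup>2"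
    proof -
      have "norm (T1 z - T2 z) \<le> n * norm z" unfolding n_def by (rule onorm[OF D])
      also have "\<dots> \<le> n * (m * norm f / d)"
        using dz x(2) d0 nm by (intro mult_left_mono) (simp_all add: pos_le_divide_eq mult.commute)
      finally have "norm (T1 z - T2 z) * norm f \<le> n * (m * norm f / d) * norm f"
        by (rule mult_right_mono) simp
      then show ?thesis
        using Cauchy_Schwarz[of "T1 z - T2 z" f] by (simp add: q_def power2_eq_square)
    qed
    also have "norm (ip (T1 y + T2 z) f) \<le> C * norm f * sqrt a"
    proof (rule order_trans[OF 1])
      have "norm x \<le> (m + 1) * norm f" using x(2) by (simp add: distrib_right add_increasing2)
      then have "sqrt (B / A\<^sup>2) * norm x \<le> sqrt (B / A\<^sup>2) * ((m + 1) * norm f)"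
        using AB by (intro mult_left_mono) auto
      then show "sqrt (B / A\<^sup>2) * norm x * sqrt a \<le> C * norm f * sqrt a"
        unfolding C_def using a0 by (intro mult_right_mono) (auto simp: mult.assoc)
    qed
    finally have "(1 - q) * norm f * norm f \<le> C * sqrt a * norm f"
      by (simp add: power2_eq_square algebra_simps)
    then have "(1 - q) * norm f \<le> C * sqrt a"
      using C a0 by (cases "f = 0") auto
    then have "(1 - q) / C * norm f \<le> sqrt a" using C by (simp add: field_simps)
    then have "((1 - q) / C * norm f)\<^sup>2 \<le> (sqrt a)\<^sup>2"
      using q C by (intro power_mono) auto
    then have "((1 - q) / C)\<^sup>2 * (norm f)\<^sup>2 \<le> a"
      using a0 unfolding power_mult_distrib by simp
    then show ?thesis unfolding a_def .
  qed
  have "0 < ((1 - q) / C)\<^sup>2" using q C by simp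
  from frame_boundsI[OF this besw lower] show ?thesis by (auto simp: is_frame_def)
qed

end

theorem theorem3p7:
  fixes scl :: "'k::rc_field \<Rightarrow> 'h::banach \<Rightarrow> 'h"
    and ip :: "'h \<Rightarrow> 'h \<Rightarrow> 'k"
    and I :: "'i set"
    and \<phi> \<psi> :: "'i \<Rightarrow> 'h"
  assumes "hilbert_space scl ip"
    and "separable (UNIV :: 'h set)"
    and "countable I"
    and "is_frame ip I \<phi>"
    and "is_frame ip I \<psi>"
  shows
    "(op_ge ip (inv (frame_op scl ip I \<phi>)) id \<and>
      (\<forall>J\<subseteq>I. frame_op scl ip I \<phi> \<circ> frame_op scl ip J \<phi> =
              frame_op scl ip J \<phi> \<circ> frame_op scl ip I \<phi>)
      \<longrightarrow> woven ip I \<phi> (\<lambda>i. inv (frame_op scl ip I \<phi>) (\<phi> i))) \<and>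
     (\<forall>T1 T2.
        riesz_basis scl I \<phi> \<and> riesz_basis scl I \<psi> \<and> woven ip I \<phi> \<psi> \<and>
        bounded_invertible_op scl T1 \<and> bounded_invertible_op scl T2 \<and>
        (\<forall>J\<subseteq>I. subspace_dist (closed_span scl (\<phi> ` J)) (closed_span scl (\<psi> ` (I - J)))
                > ereal (max (onorm (\<lambda>x. T1 x - T2 x) * onorm (inv T1))
                             (onorm (\<lambda>x. T1 x - T2 x) * onorm (inv T2))))
      \<longrightarrow> woven ip I (\<lambda>i. T1 (\<phi> i)) (\<lambda>i. T2 (\<psi> i)))"
proof (intro conjI impI allI; elim conjE)
  interpret hilbert_space scl ip by (rule assms(1))
  assume "op_ge ip (inv (frame_op scl ip I \<phi>)) id"
    and comm: "\<forall>J\<subseteq>I. frame_op scl ip I \<phi> \<circ> frame_op scl ip J \<phi> =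
      frame_op scl ip J \<phi> \<circ> frame_op scl ip I \<phi>"
  then show "woven ip I \<phi> (\<lambda>i. inv (frame_op scl ip I \<phi>) (\<phi> i))"
    by (intro woven_canonical_dual assms) auto
next
  interpret hilbert_space scl ip by (rule assms(1))
  fix T1 T2
  assume wov: "woven ip I \<phi> \<psi>"
    and T: "bounded_invertible_op scl T1" "bounded_invertible_op scl T2"
    and dist: "\<forall>J\<subseteq>I. subspace_dist (closed_span scl (\<phi> ` J)) (closed_span scl (\<psi> ` (I - J)))
      > ereal (max (onorm (\<lambda>x. T1 x - T2 x) * onorm (inv T1))
                   (onorm (\<lambda>x. T1 x - T2 x) * onorm (inv T2)))"
  obtain A B where AB: "\<And>J. J \<subseteq> I \<Longrightarrow> frame_bounds ip I (\<lambda>i. if i \<in> J then \<phi> i else \<psi> i) A B"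
    using wov by (auto simp: woven_def)
  obtain B1 B2 where bes: "bessel ip I \<phi> B1" "bessel ip I \<psi> B2"
    using assms(4,5) frame_bounds_bessel[of ip I] unfolding is_frame_def by blast
  have T2: "bounded_op scl T2" using T(2) by (simp add: bounded_invertible_op_def)
  show "woven ip I (\<lambda>i. T1 (\<phi> i)) (\<lambda>i. T2 (\<psi> i))"
  proof (rule woven_if_all_frames[OF assms(3)])
    fix J assume J: "J \<subseteq> I"
    show "is_frame ip I (\<lambda>i. if i \<in> J then T1 (\<phi> i) else T2 (\<psi> i))"
      by (rule frame_weave_images[OF AB[OF J] bes T(1) T2 J le_less_trans[OF _ dist[rule_format, OF J]]]) simp
  qed
qed

end
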